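(* There exists a constant $\delta_0>0$ such that every sense-preserving harmonic mapping $f$ in the unit disk $\mathbb{D}$ with $\|S_f\|\leq \delta_0$ is univalent (one-to-one) in $\mathbb{D}$.
   Context: Let $\mathbb{D}=\{z\in\mathbb{C}: |z|<1\}$. Every complex-valued harmonic function $f$ in $\mathbb{D}$ can be written as $f=h+\overline{g}$ with $h,g$ analytic in $\mathbb{D}$, and this decomposition is unique up to an additive constant. A sense-preserving harmonic mapping in $\mathbb{D}$ is a (locally univalent) harmonic function $f=h+\overline{g}$ with Jacobian $J_f=|h'|^2-|g'|^2>0$ in $\mathbb{D}$; equivalently, $h$ is locally univalent ($h'\neq 0$ in $\mathbb{D}$) and the (second complex) dilatation $\omega=g'/h'$ is an analytic function with $\omega(\mathbb{D})\subset\mathbb{D}$. For a locally univalent analytic function $\varphi$ in $\mathbb{D}$, the classical Schwarzian derivative is $$S(\varphi)=\left(\frac{\varphi''}{\varphi'}\right)'-\frac12\left(\frac{\varphi''}{\varphi'}\right)^2.$$ For a sense-preserving harmonic mapping $f=h+\overline{g}$ with dilatation $\omega=g'/h'$, the Schwarzian derivative is $$S_f=S(h)+\frac{\overline{\omega}}{1-|\omega|^2}\left(\frac{h''}{h'}\,\omega'-\omega''\right)-\frac32\left(\frac{\overline{\omega}\,\omega'}{1-|\omega|^2}\right)^2,$$ and the Schwarzian norm is $$\|S_f\|=\sup_{z\in\mathbb{D}}|S_f(z)|\,(1-|z|^2)^2 .$$ *)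

theory Defs
  imports "HOL-Complex_Analysis.Complex_Analysis"
begin

abbreviation unit_disk :: "complex set" where
  "unit_disk \<equiv> ball 0 1"

text \<open>
  Partial derivatives of a complex-valued function with respect to the real coordinates
  \<open>x\<close> and \<open>y\<close> of \<open>z = x + \<i>y\<close>; \<^const>\<open>frechet_derivative\<close> is the real derivative, so no
  complex differentiability is involved.
\<close>

definition partial_x :: "(complex \<Rightarrow> complex) \<Rightarrow> complex \<Rightarrow> complex" where
  "partial_x f z = frechet_derivative f (at z) 1"

definition partial_y :: "(complex \<Rightarrow> complex) \<Rightarrow> complex \<Rightarrow> complex" where
  "partial_y f z = frechet_derivative f (at z) \<i>"

definition twice_cont_differentiable_on :: "(complex \<Rightarrow> complex) \<Rightarrow> complex set \<Rightarrow> bool" where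
  "twice_cont_differentiable_on f S \<longleftrightarrow>
     f differentiable_on S \<and>
     partial_x f differentiable_on S \<and> partial_y f differentiable_on S \<and>
     continuous_on S (partial_x (partial_x f)) \<and> continuous_on S (partial_y (partial_x f)) \<and>
     continuous_on S (partial_x (partial_y f)) \<and> continuous_on S (partial_y (partial_y f))"

text \<open>The following is meant for open sets \<open>S\<close> only.\<close>

definition harmonic_on :: "(complex \<Rightarrow> complex) \<Rightarrow> complex set \<Rightarrow> bool" where
  "harmonic_on f S \<longleftrightarrow>
     twice_cont_differentiable_on f S \<and>
     (\<forall>z\<in>S. partial_x (partial_x f) z + partial_y (partial_y f) z = 0)"

definition canonical_decomposition ::
    "(complex \<Rightarrow> complex) \<Rightarrow> (complex \<Rightarrow> complex) \<Rightarrow> (complex \<Rightarrow> complex) \<Rightarrow> bool" where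
  "canonical_decomposition f h g \<longleftrightarrow>
     h holomorphic_on unit_disk \<and> g holomorphic_on unit_disk \<and>
     (\<forall>z\<in>unit_disk. f z = h z + cnj (g z))"

text \<open>
  Every harmonic function in the disk has a canonical decomposition, and the restrictions of
  \<open>h\<close> and \<open>g\<close> to the disk are unique up to additive constants. A fixed choice is made here;
  everything below depends only on the derivatives of \<open>h\<close> and \<open>g\<close> in the disk, hence not on
  the choice.
\<close>

definition canonical_parts ::
    "(complex \<Rightarrow> complex) \<Rightarrow> (complex \<Rightarrow> complex) \<times> (complex \<Rightarrow> complex)" where
  "canonical_parts f = (SOME (h, g). canonical_decomposition f h g)"

definition analytic_part :: "(complex \<Rightarrow> complex) \<Rightarrow> complex \<Rightarrow> complex" where
  "analytic_part f = fst (canonical_parts f)"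

definition coanalytic_part :: "(complex \<Rightarrow> complex) \<Rightarrow> complex \<Rightarrow> complex" where
  "coanalytic_part f = snd (canonical_parts f)"

definition jacobian :: "(complex \<Rightarrow> complex) \<Rightarrow> complex \<Rightarrow> real" where
  "jacobian f z =
     (cmod (deriv (analytic_part f) z))\<^sup>2 - (cmod (deriv (coanalytic_part f) z))\<^sup>2"

definition sense_preserving_harmonic :: "(complex \<Rightarrow> complex) \<Rightarrow> bool" where
  "sense_preserving_harmonic f \<longleftrightarrow>
     harmonic_on f unit_disk \<and> (\<forall>z\<in>unit_disk. jacobian f z > 0)"

definition dilatation :: "(complex \<Rightarrow> complex) \<Rightarrow> complex \<Rightarrow> complex" where
  "dilatation f z = deriv (coanalytic_part f) z / deriv (analytic_part f) z"

definition pre_schwarzian :: "(complex \<Rightarrow> complex) \<Rightarrow> complex \<Rightarrow> complex" where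
  "pre_schwarzian \<phi> z = deriv (deriv \<phi>) z / deriv \<phi> z"

definition schwarzian :: "(complex \<Rightarrow> complex) \<Rightarrow> complex \<Rightarrow> complex" where
  "schwarzian \<phi> z = deriv (pre_schwarzian \<phi>) z - 1/2 * (pre_schwarzian \<phi> z)\<^sup>2"

definition harmonic_schwarzian :: "(complex \<Rightarrow> complex) \<Rightarrow> complex \<Rightarrow> complex" where
  "harmonic_schwarzian f z =
     (let h = analytic_part f; \<omega> = dilatation f; d = 1 - complex_of_real ((cmod (\<omega> z))\<^sup>2) in
        schwarzian h z
        + cnj (\<omega> z) / d * (deriv (deriv h) z / deriv h z * deriv \<omega> z - deriv (deriv \<omega>) z)
        - 3/2 * (cnj (\<omega> z) * deriv \<omega> z / d)\<^sup>2)"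

text \<open>Extended real, because the supremum may be infinite.\<close>

definition schwarzian_norm :: "(complex \<Rightarrow> complex) \<Rightarrow> ereal" where
  "schwarzian_norm f =
     (SUP z\<in>unit_disk. ereal (cmod (harmonic_schwarzian f z) * (1 - (cmod z)\<^sup>2)\<^sup>2))"

end

theory Submission
  imports Defs
begin

text \<open>
  Write \<open>f = h + cnj \<circ> g\<close> with dilatation \<open>\<omega> = g'/h'\<close>. If \<open>f\<close> identifies two points, then some \<open>h + \<epsilon> g\<close>
  with \<open>|\<epsilon>| = 1\<close> identifies them too (\<open>stable_univalence\<close>). Each \<open>h + \<epsilon> g\<close> is a locally univalent holomorphic
  function, so by Nehari's theorem (\<open>Nehari_univalence_criterion\<close>) it is enough that smallness of
  \<open>\<parallel>S\<^sub>f\<parallel>\<close> forces \<open>|S(h + \<epsilon> g)(z)| (1 - |z|\<^sup>2)\<^sup>2 \<le> 2\<close> (\<open>combination_schwarzian_bound\<close>).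

  The difference between \<open>S(h + \<epsilon> g)\<close> and \<open>S\<^sub>f\<close> is governed by \<open>\<omega>'\<close> and \<open>\<omega>''\<close>, so the point is that a
  small \<open>S\<^sub>f\<close> makes \<open>\<omega>\<close> nearly constant in the hyperbolic metric. The reason is that \<open>S\<^sub>f\<close> is not
  holomorphic unless \<open>\<omega>\<close> is constant. By affine and Moebius invariance (\<open>normalization_at_point\<close>) one may look
  at the origin and assume \<open>\<omega>(0) = 0\<close>. In the expansion of \<open>S\<^sub>f\<close> in powers of \<open>z\<close> and \<open>cnj z\<close> the coefficients
  of \<open>cnj z\<close> and \<open>(cnj z)\<^sup>2\<close> are combinations of \<open>\<omega>'(0)\<close>, \<open>\<omega>''(0)\<close> and \<open>h''(0)/h'(0)\<close>; averaging over a circle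
  shows that both are small, and together they force \<open>\<omega>'(0)\<close> to be small
  (\<open>dilatation_derivative_small\<close>).

  This argument needs bounds on the Taylor remainders that are uniform in \<open>f\<close>, that is, an a priori
  bound on \<open>h''/h'\<close> near the origin. It comes from a maximum principle for the invariant pre-Schwarzian
  \<open>Q = \<partial>\<^sub>z log J\<^sub>f\<close> (\<open>harmonic_order_bound\<close>): since \<open>S\<^sub>f = Q\<^sub>z - Q\<^sup>2/2\<close> and the antiholomorphic derivative of
  \<open>Q\<close> is controlled by the Schwarz--Pick lemma, the modulus of the invariant second coefficient
  satisfies a quadratic inequality wherever it is maximal.

  Finally, the analytic and coanalytic parts of \<open>f\<close> are given by a choice, so one has to know that a
  harmonic function in the disk has such a decomposition at all
  (\<open>harmonic_on_imp_canonical_decomposition\<close>).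
\<close>

section \<open>Decomposition of harmonic functions\<close>

text \<open>
  The second difference in the directions \<open>u\<close>, \<open>v\<close> is the increment over \<open>[0, t]\<close> of
  \<open>s \<mapsto> f (z0 + t v + s u) - f (z0 + s u)\<close>, whose derivative is a first difference of \<open>f' u\<close> and hence
  \<open>t A v + o(t)\<close>. Since the second difference is symmetric in \<open>u\<close> and \<open>v\<close>, this yields Young's
  theorem below.
\<close>

lemma mixed_second_difference:
  fixes f :: "complex \<Rightarrow> complex"
  assumes S: "open S" "z0 \<in> S"
    and f: "\<And>z. z \<in> S \<Longrightarrow> (f has_derivative f' z) (at z)"
    and A: "((\<lambda>z. f' z u) has_derivative A) (at z0)"
    and uv: "norm u = 1" "norm v = 1" and e: "e > 0"
  shows "\<exists>d>0. \<forall>t. 0 < t \<and> t < d \<longrightarrow>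
     norm (f (z0 + of_real t * u + of_real t * v) - f (z0 + of_real t * u) - f (z0 + of_real t * v) + f z0
            - of_real (t\<^sup>2) * A v) \<le> e * t\<^sup>2"
proof -
  obtain d0 where d0: "d0 > 0" "ball z0 d0 \<subseteq> S" using S openE by blast
  obtain d1 where d1: "d1 > 0"
    and d1': "\<And>y. norm (y - z0) < d1 \<Longrightarrow> norm (f' y u - f' z0 u - A (y - z0)) \<le> e/3 * norm (y - z0)"
    using A e unfolding has_derivative_at_alt by (metis divide_pos_pos zero_less_numeral)
  have lin: "linear A" using A has_derivative_linear by blast
  define d where "d = min d0 d1 / 2"
  have "norm (f (z0 + of_real t * u + of_real t * v) - f (z0 + of_real t * u) - f (z0 + of_real t * v) + f z0
            - of_real (t\<^sup>2) * A v) \<le> e * t\<^sup>2" if t: "0 < t" "t < d" for t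
  proof -
    \<comment> \<open>Subtracting the main term leaves a function whose derivative is at most \<open>e t\<close>.\<close>
    define \<phi> where "\<phi> s = f (z0 + of_real t * v + s *\<^sub>R u) - f (z0 + s *\<^sub>R u) - s *\<^sub>R (t *\<^sub>R A v)" for s :: real
    define \<phi>' where "\<phi>' s = f' (z0 + of_real t * v + s *\<^sub>R u) u - f' (z0 + s *\<^sub>R u) u - t *\<^sub>R A v" for s
    have n1: "norm (of_real t * v + s *\<^sub>R u) \<le> 2 * t" if "s \<in> {0..t}" for s
    proof -
      have "norm (of_real t * v + s *\<^sub>R u) \<le> t + s"
        using norm_triangle_ineq[of "of_real t * v" "s *\<^sub>R u"] uv that by (simp add: norm_mult)
      then show ?thesis using that by simp
    qed
    have n2: "norm (s *\<^sub>R u) \<le> t" if "s \<in> {0..t}" for s using that uv by simp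
    have inS: "z0 + of_real t * v + s *\<^sub>R u \<in> S" "z0 + s *\<^sub>R u \<in> S" if "s \<in> {0..t}" for s
    proof -
      have "dist z0 (z0 + of_real t * v + s *\<^sub>R u) = norm (of_real t * v + s *\<^sub>R u)"
        by (metis add.assoc add_diff_cancel_left' dist_commute dist_norm)
      moreover have "dist z0 (z0 + s *\<^sub>R u) = norm (s *\<^sub>R u)" 
        by (metis add_diff_cancel_left' dist_commute dist_norm)
      ultimately have "z0 + of_real t * v + s *\<^sub>R u \<in> ball z0 d0" "z0 + s *\<^sub>R u \<in> ball z0 d0" using n1[OF that] n2[OF that] t unfolding d_def by auto
      then show "z0 + of_real t * v + s *\<^sub>R u \<in> S" "z0 + s *\<^sub>R u \<in> S" using d0 by blast+
    qed
    have der: "(\<phi> has_derivative (\<lambda>h. h *\<^sub>R \<phi>' s)) (at s within {0..t})" if "s \<in> {0..t}" for s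
    proof -
      have "linear (f' (z0 + of_real t * v + s *\<^sub>R u))" "linear (f' (z0 + s *\<^sub>R u))"
        using f[OF inS(1)[OF that]] f[OF inS(2)[OF that]] has_derivative_linear by blast+
      then have l: "f' (z0 + of_real t * v + s *\<^sub>R u) (h *\<^sub>R u) = h *\<^sub>R f' (z0 + of_real t * v + s *\<^sub>R u) u"
         "f' (z0 + s *\<^sub>R u) (h *\<^sub>R u) = h *\<^sub>R f' (z0 + s *\<^sub>R u) u" for h
        by (simp_all add: linear_scale)
      have c: "((\<lambda>s. z0 + of_real t * v + s *\<^sub>R u) has_derivative (\<lambda>h. h *\<^sub>R u)) (at s within {0..t})"
        "((\<lambda>s. z0 + s *\<^sub>R u) has_derivative (\<lambda>h. h *\<^sub>R u)) (at s within {0..t})"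
        by (auto intro!: derivative_eq_intros)
      have a: "((\<lambda>s. f (z0 + of_real t * v + s *\<^sub>R u)) has_derivative
          (\<lambda>h. f' (z0 + of_real t * v + s *\<^sub>R u) (h *\<^sub>R u))) (at s within {0..t})"
        by (rule has_derivative_compose[OF c(1) f[OF inS(1)[OF that]]])
      have b: "((\<lambda>s. f (z0 + s *\<^sub>R u)) has_derivative
          (\<lambda>h. f' (z0 + s *\<^sub>R u) (h *\<^sub>R u))) (at s within {0..t})"
        by (rule has_derivative_compose[OF c(2) f[OF inS(2)[OF that]]])
      show ?thesis unfolding \<phi>_def \<phi>'_def
        by (rule derivative_eq_intros a b refl)+ (simp only: l, simp add: algebra_simps)
    qed
    have bd: "onorm (\<lambda>h. h *\<^sub>R \<phi>' s) \<le> e * t" if s: "s \<in> {0..t}" for s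
    proof -
      let ?a = "f' (z0 + of_real t * v + s *\<^sub>R u) u - f' z0 u - A (of_real t * v + s *\<^sub>R u)"
      let ?b = "f' (z0 + s *\<^sub>R u) u - f' z0 u - A (s *\<^sub>R u)"
      have "A (of_real t * v + s *\<^sub>R u) = t *\<^sub>R A v + A (s *\<^sub>R u)"
        using lin by (simp add: linear_add linear_scale flip: scaleR_conv_of_real)
      then have "\<phi>' s = ?a - ?b" unfolding \<phi>'_def by simp
      moreover have "norm ?a \<le> e/3 * (2*t)"
      proof -
        have "norm ?a \<le> e/3 * norm (of_real t * v + s *\<^sub>R u)"
          using d1'[of "z0 + of_real t * v + s *\<^sub>R u"] n1[OF s] t unfolding d_def by (simp add: add.assoc)
        also have "\<dots> \<le> e/3 * (2*t)" using n1[OF s] e by (intro mult_left_mono) auto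
        finally show ?thesis .
      qed
      moreover have "norm ?b \<le> e/3 * t"
      proof -
        have "norm ?b \<le> e/3 * norm (s *\<^sub>R u)"
          using d1'[of "z0 + s *\<^sub>R u"] n2[OF s] t unfolding d_def by simp
        also have "\<dots> \<le> e/3 * t" using n2[OF s] e by (intro mult_left_mono) auto
        finally show ?thesis .
      qed
      ultimately have "norm (\<phi>' s) \<le> e * t" using norm_triangle_ineq4[of ?a ?b] by simp
      then show ?thesis by (intro onorm_bound) (use e t in \<open>auto simp: mult.commute mult_left_mono\<close>)
    qed
    have "norm (\<phi> t - \<phi> 0) \<le> e * t * norm (t - 0)"
      by (rule differentiable_bound[OF convex_real_interval(5) der bd]) (use t in auto)
    then show ?thesis using t unfolding \<phi>_def by (simp add: scaleR_conv_of_real power2_eq_square algebra_simps)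
  qed
  moreover have "d > 0" using d0 d1 unfolding d_def by simp
  ultimately show ?thesis by blast
qed

lemma mixed_partials_commute:
  fixes f :: "complex \<Rightarrow> complex"
  assumes S: "open S" "z0 \<in> S"
    and f: "\<And>z. z \<in> S \<Longrightarrow> (f has_derivative f' z) (at z)"
    and A: "((\<lambda>z. f' z u) has_derivative A) (at z0)"
    and B: "((\<lambda>z. f' z v) has_derivative B) (at z0)"
    and uv: "norm u = 1" "norm v = 1"
  shows "A v = B u"
proof -
  have "norm (A v - B u) \<le> e" if "e > 0" for e
  proof -
    obtain d1 where d1: "d1 > 0" "\<And>t. 0 < t \<Longrightarrow> t < d1 \<Longrightarrow> norm (f (z0 + of_real t * u + of_real t * v) - f (z0 + of_real t * u) - f (z0 + of_real t * v) + f z0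
            - of_real (t\<^sup>2) * A v) \<le> e/2 * t\<^sup>2"
      using mixed_second_difference[OF S f A uv, of "e/2"] \<open>e>0\<close> by auto
    obtain d2 where d2: "d2 > 0" "\<And>t. 0 < t \<Longrightarrow> t < d2 \<Longrightarrow> norm (f (z0 + of_real t * v + of_real t * u) - f (z0 + of_real t * v) - f (z0 + of_real t * u) + f z0
            - of_real (t\<^sup>2) * B u) \<le> e/2 * t\<^sup>2"
      using mixed_second_difference[OF S f B uv(2) uv(1), of "e/2"] \<open>e>0\<close> by auto
    define t where "t = min d1 d2 / 2"
    have t: "0 < t" "t < d1" "t < d2" using d1(1) d2(1) unfolding t_def by auto
    define D where "D = f (z0 + of_real t * u + of_real t * v) - f (z0 + of_real t * u) - f (z0 + of_real t * v) + f z0"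
    have 1: "norm (D - of_real (t\<^sup>2) * A v) \<le> e/2 * t\<^sup>2" using d1(2) t unfolding D_def by simp
    have 2: "norm (D - of_real (t\<^sup>2) * B u) \<le> e/2 * t\<^sup>2" using d2(2) t unfolding D_def by (simp add: algebra_simps)
    have "of_real (t\<^sup>2) * (A v - B u) = (D - of_real (t\<^sup>2) * B u) - (D - of_real (t\<^sup>2) * A v)" by (simp add: algebra_simps)
    then have "norm (of_real (t\<^sup>2) * (A v - B u)) \<le> e * t\<^sup>2"
      using 1 2 norm_triangle_ineq4[of "D - of_real (t\<^sup>2) * B u" "D - of_real (t\<^sup>2) * A v"] by simp
    then show ?thesis using t by (simp add: norm_mult norm_power)
  qed
  then have "norm (A v - B u) \<le> 0" by (rule field_le_epsilon[of _ 0, simplified])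
  then show ?thesis by simp
qed

lemma real_linear_complex:
  assumes "linear (L :: complex \<Rightarrow> complex)"
  shows "L \<zeta> = of_real (Re \<zeta>) * L 1 + of_real (Im \<zeta>) * L \<i>"
proof -
  have "\<zeta> = Re \<zeta> *\<^sub>R 1 + Im \<zeta> *\<^sub>R \<i>" by (simp add: complex_eq_iff)
  then have "L \<zeta> = L (Re \<zeta> *\<^sub>R 1) + L (Im \<zeta> *\<^sub>R \<i>)" by (metis assms linear_add)
  also have "\<dots> = Re \<zeta> *\<^sub>R L 1 + Im \<zeta> *\<^sub>R L \<i>" using assms by (simp only: linear_scale)
  finally show ?thesis by (simp add: scaleR_conv_of_real)
qed

lemma Cauchy_Riemann_field_derivative:
  assumes f: "(f has_derivative L) (at z)" and CR: "L \<i> = \<i> * L 1"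
  shows "\<exists>f'. (f has_field_derivative f') (at z)"
proof -
  have "linear L" using f has_derivative_linear by blast
  then have "L = (*) (L 1)"
    using CR by (intro ext, subst real_linear_complex) (auto simp: complex_eq_iff algebra_simps)
  then show ?thesis using f by (metis has_field_derivative_def)
qed

text \<open>
  The function \<open>F = (\<partial>\<^sub>x f - \<i> \<partial>\<^sub>y f) / 2\<close> satisfies the Cauchy--Riemann equation because \<open>f\<close> is
  harmonic and its mixed partials agree. A primitive \<open>h\<close> of \<open>F\<close> in the disk has the same
  \<open>z\<close>-derivative as \<open>f\<close>, so \<open>f - h\<close> is antiholomorphic. The existence proved here is what gives
  \<^const>\<open>canonical_parts\<close>, a choice by \<open>SOME\<close>, its meaning.
\<close>

lemma harmonic_on_imp_canonical_decomposition:
  assumes "harmonic_on f unit_disk"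
  shows "\<exists>h g. canonical_decomposition f h g"
proof -
  let ?L = "\<lambda>z. frechet_derivative f (at z)"
  have at: "at z within unit_disk = at z" if "z \<in> unit_disk" for z :: complex
    by (rule at_within_open[OF that open_ball])
  have d: "f differentiable (at z)" "partial_x f differentiable (at z)" "partial_y f differentiable (at z)"
    if "z \<in> unit_disk" for z
  proof -
    have "f differentiable (at z within unit_disk)" "partial_x f differentiable (at z within unit_disk)"
      "partial_y f differentiable (at z within unit_disk)"
      using assms that unfolding harmonic_on_def twice_cont_differentiable_on_def differentiable_on_def by blast+
    then show "f differentiable (at z)" "partial_x f differentiable (at z)" "partial_y f differentiable (at z)"
      by (simp_all only: at[OF that])
  qed
  have f: "(f has_derivative ?L z) (at z)" if "z \<in> unit_disk" for z
    using d(1)[OF that] frechet_derivative_works by blast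
  define X where "X z = frechet_derivative (partial_x f) (at z)" for z
  define Y where "Y z = frechet_derivative (partial_y f) (at z)" for z
  have X: "(partial_x f has_derivative X z) (at z)" if "z \<in> unit_disk" for z
    using d(2)[OF that] frechet_derivative_works unfolding X_def by blast
  have Y: "(partial_y f has_derivative Y z) (at z)" if "z \<in> unit_disk" for z
    using d(3)[OF that] frechet_derivative_works unfolding Y_def by blast
  have mixed: "X z \<i> = Y z 1" if "z \<in> unit_disk" for z
    by (rule mixed_partials_commute[OF open_ball that f _ _ norm_one])
       (use X[OF that] Y[OF that] in \<open>simp_all add: partial_x_def[abs_def] partial_y_def[abs_def]\<close>)
  have lap: "X z 1 + Y z \<i> = 0" if "z \<in> unit_disk" for z
    using assms that unfolding harmonic_on_def X_def Y_def partial_x_def[of "partial_x f"] partial_y_def[of "partial_y f"] by blast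
  define F where "F z = 1/2 * (partial_x f z - \<i> * partial_y f z)" for z
  have "\<exists>F'. (F has_field_derivative F') (at z)" if z: "z \<in> unit_disk" for z
  proof -
    have "(F has_derivative (\<lambda>\<zeta>. 1/2 * (X z \<zeta> - \<i> * Y z \<zeta>))) (at z)"
      unfolding F_def by (rule derivative_eq_intros X Y z refl)+ simp
    moreover have "1/2 * (X z \<i> - \<i> * Y z \<i>) = \<i> * (1/2 * (X z 1 - \<i> * Y z 1))"
      using mixed[OF z] lap[OF z] by (simp add: add_eq_0_iff algebra_simps)
    ultimately show ?thesis by (rule Cauchy_Riemann_field_derivative)
  qed
  then have "F holomorphic_on unit_disk"
    by (simp add: holomorphic_on_open)
  then obtain h where h': "\<And>z. z \<in> unit_disk \<Longrightarrow> (h has_field_derivative F z) (at z)"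
    using holomorphic_convex_primitive'[of unit_disk F] by (auto simp: at)
  define g where "g z = cnj (f z - h z)" for z
  have "\<exists>g'. (g has_field_derivative g') (at z)" if z: "z \<in> unit_disk" for z
  proof -
    have "(g has_derivative (\<lambda>\<zeta>. cnj (?L z \<zeta> - F z * \<zeta>))) (at z)"
      unfolding g_def
      by (rule derivative_eq_intros f z h'[OF z, unfolded has_field_derivative_def] refl)+
    moreover have "cnj (?L z \<i> - F z * \<i>) = \<i> * cnj (?L z 1 - F z * 1)"
      unfolding F_def partial_x_def partial_y_def by (simp add: complex_eq_iff algebra_simps)
    ultimately show ?thesis by (rule Cauchy_Riemann_field_derivative)
  qed
  then have "g holomorphic_on unit_disk"
    by (simp add: holomorphic_on_open)
  moreover have "h holomorphic_on unit_disk"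
    unfolding holomorphic_on_open[OF open_ball] using h' by blast
  ultimately have "canonical_decomposition f h g"
    unfolding canonical_decomposition_def g_def by simp
  then show ?thesis by blast
qed

section \<open>The Schwarzian derivative and disk automorphisms\<close>

lemma eventually_nhds_open: "open S \<Longrightarrow> z \<in> S \<Longrightarrow> (\<And>w. w \<in> S \<Longrightarrow> P w) \<Longrightarrow> \<forall>\<^sub>F w in nhds z. P w"
  using eventually_nhds by blast

lemma deriv_eq_on_open:
  assumes "open S" "z \<in> S" "\<And>w. w \<in> S \<Longrightarrow> f w = g w"
  shows "deriv f z = deriv g z"
  by (rule deriv_cong_ev) (use assms in \<open>auto intro: eventually_nhds_open\<close>)

lemma pre_schwarzian_holomorphic:
  assumes "\<phi> holomorphic_on S" "open S" "\<And>z. z \<in> S \<Longrightarrow> deriv \<phi> z \<noteq> 0"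
  shows "pre_schwarzian \<phi> holomorphic_on S"
  unfolding pre_schwarzian_def[abs_def] using assms by (intro holomorphic_intros) auto

lemma schwarzian_holomorphic:
  assumes "\<phi> holomorphic_on S" "open S" "\<And>z. z \<in> S \<Longrightarrow> deriv \<phi> z \<noteq> 0"
  shows "schwarzian \<phi> holomorphic_on S"
  unfolding schwarzian_def[abs_def]
  by (intro holomorphic_intros pre_schwarzian_holomorphic assms)

lemma schwarzian_eqI:
  assumes "open S" "z \<in> S" "\<And>w. w \<in> S \<Longrightarrow> pre_schwarzian \<phi> w = p w" "(p has_field_derivative p') (at z)"
  shows "schwarzian \<phi> z = p' - 1/2 * (p z)\<^sup>2"
  unfolding schwarzian_def using deriv_eq_on_open[OF assms(1-3)] assms(2-) by (simp add: DERIV_imp_deriv)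

text \<open>
  The pre-Schwarzian is the logarithmic derivative of \<open>\<phi>'\<close>, so a factor \<open>k\<close> of \<open>\<phi>'\<close> contributes
  \<open>k' / k\<close>. Scaling, composition and linear combinations \<open>h + a g\<close> are all instances.
\<close>

lemma pre_schwarzian_multiplier:
  assumes S: "open S" "z \<in> S" and \<phi>: "\<And>w. w \<in> S \<Longrightarrow> deriv \<phi> w = deriv h w * k w"
    and h: "h holomorphic_on S" "deriv h z \<noteq> 0" and k: "(k has_field_derivative k') (at z)" "k z \<noteq> 0"
  shows "pre_schwarzian \<phi> z = pre_schwarzian h z + k' / k z"
proof -
  have hh: "(deriv h has_field_derivative deriv (deriv h) z) (at z)"
    using h S by (metis holomorphic_deriv holomorphic_derivI)
  have "((\<lambda>w. deriv h w * k w) has_field_derivative deriv (deriv h) z * k z + deriv h z * k') (at z)"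
    using DERIV_mult[OF hh k(1)] by (simp add: algebra_simps)
  then have "deriv (deriv \<phi>) z = deriv (deriv h) z * k z + deriv h z * k'"
    using deriv_eq_on_open[OF S \<phi>] by (simp add: DERIV_imp_deriv)
  then show ?thesis unfolding pre_schwarzian_def using \<phi>[OF S(2)] h(2) k(2) by (simp add: field_simps)
qed

lemma schwarzian_scale:
  assumes "open S" "z \<in> S" "\<phi> holomorphic_on S" "\<And>w. w \<in> S \<Longrightarrow> deriv \<phi> w \<noteq> 0" "c \<noteq> 0"
  shows "schwarzian (\<lambda>w. c * \<phi> w) z = schwarzian \<phi> z"
proof -
  have d: "deriv (\<lambda>w. c * \<phi> w) w = deriv \<phi> w * c" if "w \<in> S" for w
    using assms that by (simp add: holomorphic_on_imp_differentiable_at)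
  have "pre_schwarzian (\<lambda>w. c * \<phi> w) w = pre_schwarzian \<phi> w" if "w \<in> S" for w
    using pre_schwarzian_multiplier[OF assms(1) that d assms(3) assms(4)[OF that], of 0] assms(5) by simp
  then show ?thesis unfolding schwarzian_def using deriv_eq_on_open[OF assms(1,2)] assms(2) by metis
qed

lemma schwarzian_compose:
  assumes S: "open S" "open T" "m ` T \<subseteq> S" "z \<in> T"
    and \<phi>: "\<phi> holomorphic_on S" "\<And>w. w \<in> S \<Longrightarrow> deriv \<phi> w \<noteq> 0"
    and m: "m holomorphic_on T" "\<And>w. w \<in> T \<Longrightarrow> deriv m w \<noteq> 0"
  shows "schwarzian (\<phi> \<circ> m) z = schwarzian \<phi> (m z) * (deriv m z)\<^sup>2 + schwarzian m z"
proof -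
  have mS: "m w \<in> S" if "w \<in> T" for w using that S(3) by blast
  have m1: "(m has_field_derivative deriv m w) (at w)" if "w \<in> T" for w
    using m(1) S(2) that by (metis holomorphic_derivI)
  have m2: "(deriv m has_field_derivative deriv (deriv m) w) (at w)" if "w \<in> T" for w
    using m(1) S(2) that by (metis holomorphic_deriv holomorphic_derivI)
  have chain: "((\<lambda>v. f (m v)) has_field_derivative deriv f (m w) * deriv m w) (at w)"
    if "w \<in> T" "f holomorphic_on S" for w f
    using DERIV_chain2[OF holomorphic_derivI[OF that(2) S(1) mS[OF that(1)]] m1[OF that(1)]] .
  have d: "deriv (\<phi> \<circ> m) w = deriv m w * deriv \<phi> (m w)" if "w \<in> T" for w
    using chain[OF that \<phi>(1)] by (simp add: DERIV_imp_deriv o_def)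
  have pre: "pre_schwarzian (\<phi> \<circ> m) w = pre_schwarzian \<phi> (m w) * deriv m w + pre_schwarzian m w" if w: "w \<in> T" for w
    using pre_schwarzian_multiplier[OF S(2) w d m(1) m(2)[OF w] chain[OF w holomorphic_deriv[OF \<phi>(1) S(1)]]]
      \<phi>(2)[OF mS[OF w]] by (simp add: pre_schwarzian_def)
  have "((\<lambda>w. pre_schwarzian \<phi> (m w) * deriv m w + pre_schwarzian m w) has_field_derivative
      deriv (pre_schwarzian \<phi>) (m z) * deriv m z * deriv m z + pre_schwarzian \<phi> (m z) * deriv (deriv m) z
       + deriv (pre_schwarzian m) z) (at z)"
    by (rule derivative_eq_intros refl m2 S chain pre_schwarzian_holomorphic \<phi> 
         holomorphic_derivI[OF pre_schwarzian_holomorphic[OF m(1) S(2) m(2)] S(2)] | assumption)+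
       (simp add: algebra_simps)
  from schwarzian_eqI[OF S(2,4) _ this, of "\<phi> \<circ> m"] pre
  have eq: "schwarzian (\<phi> \<circ> m) z = deriv (pre_schwarzian \<phi>) (m z) * deriv m z * deriv m z + pre_schwarzian \<phi> (m z) * deriv (deriv m) z
       + deriv (pre_schwarzian m) z - 1/2 * (pre_schwarzian \<phi> (m z) * deriv m z + pre_schwarzian m z)\<^sup>2"
    by blast
  have "deriv (deriv m) z = pre_schwarzian m z * deriv m z"
    using m(2)[OF S(4)] by (simp add: pre_schwarzian_def)
  then show ?thesis unfolding eq schwarzian_def[of \<phi>] schwarzian_def[of m]
    by (simp add: power2_eq_square algebra_simps)
qed

text \<open>
  The automorphism of the disk that moves \<open>0\<close> to \<open>b\<close>.
\<close>

definition disk_shift :: "complex \<Rightarrow> complex \<Rightarrow> complex" where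
  "disk_shift b z = (z + b) / (1 + cnj b * z)"

lemma disk_shift_denom: "cmod b < 1 \<Longrightarrow> cmod z < 1 \<Longrightarrow> 1 + cnj b * z \<noteq> 0"
proof
  assume "cmod b < 1" "cmod z < 1" "1 + cnj b * z = 0"
  then have "cmod b * cmod z = 1" by (metis add_eq_0_iff complex_mod_cnj norm_minus_cancel norm_mult norm_one)
  moreover have "cmod b * cmod z < 1 * 1" using \<open>cmod b < 1\<close> \<open>cmod z < 1\<close> by (intro mult_strict_mono') auto
  ultimately show False by simp
qed

lemma disk_shift_deriv:
  assumes "cmod b < 1" "cmod z < 1"
  shows "(disk_shift b has_field_derivative (1 - cnj b * b) / (1 + cnj b * z)\<^sup>2) (at z)"
  unfolding disk_shift_def[abs_def] using disk_shift_denom[OF assms]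
  by (auto intro!: derivative_eq_intros simp: field_simps power2_eq_square)

lemma one_minus_disk_shift:
  assumes "cmod b < 1" "cmod z < 1"
  shows "1 - (cmod (disk_shift b z))\<^sup>2 = (1 - (cmod b)\<^sup>2) * (1 - (cmod z)\<^sup>2) / (cmod (1 + cnj b * z))\<^sup>2"
proof -
  have "(cmod (1 + cnj b * z))\<^sup>2 - (cmod (z + b))\<^sup>2 = (1 - (cmod b)\<^sup>2) * (1 - (cmod z)\<^sup>2)"
    by (simp add: cmod_power2) (simp add: power2_eq_square algebra_simps)
  then show ?thesis using disk_shift_denom[OF assms]
    by (simp add: disk_shift_def norm_divide field_simps)
qed

lemma disk_shift_in_disk:
  assumes "cmod b < 1" "cmod z < 1"
  shows "cmod (disk_shift b z) < 1"
proof -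
  have "0 < (1 - (cmod b)\<^sup>2) * (1 - (cmod z)\<^sup>2) / (cmod (1 + cnj b * z))\<^sup>2"
    using assms disk_shift_denom[OF assms] by (intro divide_pos_pos mult_pos_pos) (auto simp: abs_square_less_1)
  then have "(cmod (disk_shift b z))\<^sup>2 < 1" using one_minus_disk_shift[OF assms] by simp
  then show ?thesis by (simp add: abs_square_less_1)
qed

lemma disk_shift_inverse:
  assumes "cmod b < 1" "cmod z < 1"
  shows "disk_shift b (disk_shift (- b) z) = z"
proof -
  have "1 - cnj b * z \<noteq> 0" using disk_shift_denom[of "-b" z] assms by simp
  moreover have "1 - b * cnj b \<noteq> 0" using disk_shift_denom[of "-b" b] assms by (simp add: mult.commute)
  ultimately show ?thesis unfolding disk_shift_def
    by (simp add: divide_simps) (simp add: algebra_simps)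
qed

lemma disk_shift_facts:
  assumes "cmod b < 1"
  shows "disk_shift b holomorphic_on unit_disk" "disk_shift b ` unit_disk \<subseteq> unit_disk" "disk_shift b 0 = b"
    and "\<And>z. z \<in> unit_disk \<Longrightarrow> deriv (disk_shift b) z = (1 - cnj b * b) / (1 + cnj b * z)\<^sup>2"
    and "\<And>z. z \<in> unit_disk \<Longrightarrow> deriv (disk_shift b) z \<noteq> 0"
    and "\<And>z. z \<in> unit_disk \<Longrightarrow> cmod (deriv (disk_shift b) z) * (1 - (cmod z)\<^sup>2) = 1 - (cmod (disk_shift b z))\<^sup>2"
proof -
  show "disk_shift b holomorphic_on unit_disk"
    unfolding holomorphic_on_open[OF open_ball] using disk_shift_deriv[OF assms] by (metis mem_ball_0)
  show "disk_shift b ` unit_disk \<subseteq> unit_disk" using disk_shift_in_disk[OF assms] by auto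
  show "disk_shift b 0 = b" by (simp add: disk_shift_def)
  show D: "deriv (disk_shift b) z = (1 - cnj b * b) / (1 + cnj b * z)\<^sup>2" if "z \<in> unit_disk" for z
    using disk_shift_deriv[OF assms] that by (simp add: DERIV_imp_deriv)
  have b: "1 - cnj b * b = of_real (1 - (cmod b)\<^sup>2)" by (simp add: complex_norm_square[symmetric] mult.commute)
  have p: "1 - (cmod b)\<^sup>2 > 0" using assms by (simp add: abs_square_less_1)
  show "deriv (disk_shift b) z \<noteq> 0" if "z \<in> unit_disk" for z
    unfolding D[OF that] b using p disk_shift_denom[OF assms, of z] that
    by (simp del: of_real_diff of_real_power)
  show "cmod (deriv (disk_shift b) z) * (1 - (cmod z)\<^sup>2) = 1 - (cmod (disk_shift b z))\<^sup>2" if "z \<in> unit_disk" for z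
    unfolding D[OF that] b norm_divide norm_of_real using p one_minus_disk_shift[OF assms] that by (simp add: norm_power)
qed

lemma schwarzian_disk_shift:
  assumes b: "cmod b < 1" and z: "z \<in> unit_disk"
  shows "schwarzian (disk_shift b) z = 0"
proof -
  have d: "((\<lambda>z. (1 - cnj b * b) / (1 + cnj b * z)\<^sup>2) has_field_derivative
       - 2 * cnj b * (1 - cnj b * b) / (1 + cnj b * w)^3) (at w)" if "w \<in> unit_disk" for w
    using disk_shift_denom[OF b, of w] that
    by (auto intro!: derivative_eq_intros simp: divide_simps power2_eq_square power3_eq_cube)
  have "pre_schwarzian (disk_shift b) w = - 2 * cnj b / (1 + cnj b * w)" if w: "w \<in> unit_disk" for w
  proof -
    have "deriv (deriv (disk_shift b)) w = - 2 * cnj b * (1 - cnj b * b) / (1 + cnj b * w)^3"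
      using deriv_eq_on_open[OF open_ball w disk_shift_facts(4)[OF b]] d[OF w] by (simp add: DERIV_imp_deriv)
    moreover have "1 - cnj b * b \<noteq> 0" using disk_shift_denom[of "-b" b] b by simp
    ultimately show ?thesis unfolding pre_schwarzian_def disk_shift_facts(4)[OF b w]
      using disk_shift_denom[OF b, of w] w by (simp add: divide_simps power2_eq_square power3_eq_cube mult.assoc)
  qed
  moreover have "((\<lambda>w. - 2 * cnj b / (1 + cnj b * w)) has_field_derivative 2 * (cnj b)\<^sup>2 / (1 + cnj b * z)\<^sup>2) (at z)"
    using disk_shift_denom[OF b, of z] z
    by (auto intro!: derivative_eq_intros simp: divide_simps power2_eq_square)
  ultimately have "schwarzian (disk_shift b) z = 2 * (cnj b)\<^sup>2 / (1 + cnj b * z)\<^sup>2 - 1/2 * (- 2 * cnj b / (1 + cnj b * z))\<^sup>2"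
    by (rule schwarzian_eqI[OF open_ball z])
  then show ?thesis by (simp add: power_divide power2_eq_square)
qed

text \<open>
  The Schwarzian of a Moebius map vanishes, so the chain rule loses its second term. Together with
  \<open>|\<tau>'(z)| (1 - |z|\<^sup>2) = 1 - |\<tau>(z)|\<^sup>2\<close> for a disk automorphism \<open>\<tau>\<close>, this makes
  \<open>|S(\<phi>)(z)| (1 - |z|\<^sup>2)\<^sup>2\<close> invariant.
\<close>

lemma schwarzian_compose_disk_shift:
  assumes "\<phi> holomorphic_on unit_disk" "\<And>z. z \<in> unit_disk \<Longrightarrow> deriv \<phi> z \<noteq> 0" "cmod b < 1" "z \<in> unit_disk"
  shows "schwarzian (\<phi> \<circ> disk_shift b) z = schwarzian \<phi> (disk_shift b z) * (deriv (disk_shift b) z)\<^sup>2"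
  using schwarzian_compose[OF open_ball open_ball disk_shift_facts(2) assms(4,1,2) disk_shift_facts(1,5)] assms
  by (simp add: schwarzian_disk_shift)

lemma deriv_compose_disk_shift:
  assumes "\<phi> holomorphic_on unit_disk" "cmod b < 1" "z \<in> unit_disk"
  shows "deriv (\<phi> \<circ> disk_shift b) z = deriv \<phi> (disk_shift b z) * deriv (disk_shift b) z"
proof -
  have "disk_shift b z \<in> unit_disk" using disk_shift_facts(2) assms by blast
  then show ?thesis
    using assms disk_shift_facts(1)[OF assms(2)]
    by (intro deriv_chain) (auto intro: holomorphic_on_imp_differentiable_at)
qed

lemma holomorphic_compose_disk_shift:
  assumes "\<phi> holomorphic_on unit_disk" "cmod b < 1"
  shows "(\<phi> \<circ> disk_shift b) holomorphic_on unit_disk"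
  by (rule holomorphic_on_compose_gen[OF disk_shift_facts(1) assms(1) disk_shift_facts(2)]) fact+

section \<open>Nehari's univalence criterion\<close>

text \<open>
  The function \<open>y = \<phi> (\<phi>')\<^bsup>-1/2\<^esup>\<close> solves \<open>y'' + (S(\<phi>)/2) y = 0\<close>, and it has the same zeros as \<open>\<phi>\<close>, all
  of them simple. Univalence thereby becomes a statement about zeros of solutions.
\<close>

lemma schwarzian_linear_ode:
  assumes \<phi>: "\<phi> holomorphic_on unit_disk" "\<And>z. z \<in> unit_disk \<Longrightarrow> deriv \<phi> z \<noteq> 0"
  shows "\<exists>y y'. \<forall>z\<in>unit_disk.
     (y has_field_derivative y' z) (at z) \<and>
     (y' has_field_derivative - (schwarzian \<phi> z / 2) * y z) (at z) \<and>
     (\<phi> z = 0 \<longleftrightarrow> y z = 0) \<and> (y z = 0 \<longrightarrow> y' z \<noteq> 0)"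
proof -
  have d\<phi>: "deriv \<phi> holomorphic_on unit_disk" using \<phi>(1) by (intro holomorphic_intros) auto
  obtain l where l: "l holomorphic_on unit_disk" "\<And>z. z \<in> unit_disk \<Longrightarrow> exp (l z) = deriv \<phi> z"
    using holomorphic_logarithm_exists[OF convex_ball open_ball d\<phi> \<phi>(2), of 0] by auto
  let ?P = "pre_schwarzian \<phi>"
  have P: "(?P has_field_derivative deriv ?P z) (at z)" if "z \<in> unit_disk" for z
    using holomorphic_derivI[OF pre_schwarzian_holomorphic[OF \<phi>(1) open_ball \<phi>(2)] open_ball that] .
  have l': "(l has_field_derivative ?P z) (at z)" if z: "z \<in> unit_disk" for z
  proof -
    have 1: "(l has_field_derivative deriv l z) (at z)" using holomorphic_derivI[OF l(1) open_ball z] .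
    have "((\<lambda>z. exp (l z)) has_field_derivative exp (l z) * deriv l z) (at z)"
      using DERIV_chain2[OF DERIV_exp 1] .
    then have "deriv (deriv \<phi>) z = exp (l z) * deriv l z"
      using deriv_eq_on_open[OF open_ball z, of "\<lambda>z. exp (l z)"] l(2) DERIV_imp_deriv by metis
    then have "deriv l z = ?P z" unfolding pre_schwarzian_def using l(2)[OF z] \<phi>(2)[OF z] by (simp add: field_simps)
    then show ?thesis using 1 by simp
  qed
  \<comment> \<open>A holomorphic branch of \<open>(\<phi>')\<^bsup>-1/2\<^esup>\<close>.\<close>
  define k where "k z = exp (- (1/2) * l z)" for z
  have k: "(k has_field_derivative - (1/2) * ?P z * k z) (at z)" if "z \<in> unit_disk" for z
    unfolding k_def by (rule derivative_eq_intros l' that refl)+ simp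
  have k2: "k z * deriv \<phi> z = inverse (k z)" if "z \<in> unit_disk" for z
    unfolding k_def l(2)[OF that, symmetric] exp_minus[symmetric] mult_exp_exp by simp
  have k0: "k z \<noteq> 0" for z unfolding k_def by simp
  define y where "y z = \<phi> z * k z" for z
  define y' where "y' z = inverse (k z) - (1/2) * ?P z * y z" for z
  have y: "(y has_field_derivative y' z) (at z)" if z: "z \<in> unit_disk" for z
  proof -
    have "(y has_field_derivative deriv \<phi> z * k z + (- (1/2) * ?P z * k z) * \<phi> z) (at z)"
      unfolding y_def by (rule DERIV_mult[OF holomorphic_derivI[OF \<phi>(1) open_ball z] k[OF z]])
    then show ?thesis using k2[OF z] unfolding y'_def y_def by (simp add: algebra_simps)
  qed
  have ik: "((\<lambda>z. inverse (k z)) has_field_derivative (1/2) * ?P z * inverse (k z)) (at z)" if "z \<in> unit_disk" for z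
    using k0 by (auto intro!: derivative_eq_intros k[OF that] simp: field_simps)
  have "(y' has_field_derivative - (schwarzian \<phi> z / 2) * y z) (at z)" if z: "z \<in> unit_disk" for z
    unfolding y'_def
    by (rule DERIV_cong[OF DERIV_diff[OF ik[OF z] DERIV_mult[OF DERIV_cmult[OF P[OF z], of "1/2"] y[OF z]]]])
       (simp add: y'_def schwarzian_def power2_eq_square field_simps)
  then show ?thesis using y k0 by (intro exI[of _ y] exI[of _ y']) (auto simp: y_def y'_def)
qed

text \<open>
  The real
  equation \<open>v'' = - (1 - x\<^sup>2)\<^bsup>-2\<^esup> v\<close> has the positive solution \<open>v = (1 - x\<^sup>2)\<^bsup>1/2\<^esup>\<close>, with
  \<open>- v'/v = x / (1 - x\<^sup>2)\<close>. Completing the square with this weight shows that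
  \<open>F = Re (Y' \<cdot> cnj Y) + x / (1 - x\<^sup>2) |Y|\<^sup>2\<close> is nondecreasing; it vanishes at both zeros of \<open>Y\<close>, although
  \<open>F'(0) = |Y'(0)|\<^sup>2 > 0\<close>.
\<close>

lemma Nehari_ode_no_two_zeros:
  fixes Y Y' q :: "real \<Rightarrow> complex"
  assumes r: "0 < r" "r < 1"
    and Y: "\<And>x. 0 \<le> x \<Longrightarrow> x \<le> r \<Longrightarrow> (Y has_vector_derivative Y' x) (at x)"
    and Y': "\<And>x. 0 \<le> x \<Longrightarrow> x \<le> r \<Longrightarrow> (Y' has_vector_derivative - q x * Y x) (at x)"
    and q: "\<And>x. 0 \<le> x \<Longrightarrow> x \<le> r \<Longrightarrow> cmod (q x) * (1 - x\<^sup>2)\<^sup>2 \<le> 1"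
    and 0: "Y 0 = 0" "Y' 0 \<noteq> 0" "Y r = 0"
  shows False
proof -
  define F where "F x = Re (Y' x * cnj (Y x)) + x / (1 - x\<^sup>2) * (Re (Y x * cnj (Y x)))" for x
  define F' where "F' x = (cmod (Y' x + of_real (x / (1 - x\<^sup>2)) * Y x))\<^sup>2
       + (1 / (1 - x\<^sup>2)\<^sup>2 - Re (q x)) * (cmod (Y x))\<^sup>2" for x
  have F: "(F has_real_derivative F' x) (at x)" if x: "0 \<le> x" "x \<le> r" for x
  proof -
    have nz: "1 - x\<^sup>2 \<noteq> 0" using x r by (simp add: power2_eq_1_iff)
    have g: "((\<lambda>x. x / (1 - x\<^sup>2)) has_real_derivative (1 + x\<^sup>2) / (1 - x\<^sup>2)\<^sup>2) (at x)"
      using nz by (auto intro!: derivative_eq_intros simp: divide_simps) (simp add: power2_eq_square algebra_simps)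
    have cY: "((\<lambda>x. cnj (Y x)) has_vector_derivative cnj (Y' x)) (at x)"
      by (rule bounded_linear.has_vector_derivative[OF bounded_linear_cnj Y[OF x]])
    have 1: "((\<lambda>x. Re (Y' x * cnj (Y x))) has_real_derivative Re (Y' x * cnj (Y' x) + - q x * Y x * cnj (Y x))) (at x)"
      using bounded_linear.has_vector_derivative[OF bounded_linear_Re has_vector_derivative_mult[OF Y'[OF x] cY]]
      by (simp add: has_real_derivative_iff_has_vector_derivative)
    have 2: "((\<lambda>x. Re (Y x * cnj (Y x))) has_real_derivative Re (Y x * cnj (Y' x) + Y' x * cnj (Y x))) (at x)"
      using bounded_linear.has_vector_derivative[OF bounded_linear_Re has_vector_derivative_mult[OF Y[OF x] cY]]
      by (simp add: has_real_derivative_iff_has_vector_derivative)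
    have 3: "(F has_real_derivative Re (Y' x * cnj (Y' x) + - q x * Y x * cnj (Y x)) +
       ((1 + x\<^sup>2) / (1 - x\<^sup>2)\<^sup>2 * Re (Y x * cnj (Y x)) + Re (Y x * cnj (Y' x) + Y' x * cnj (Y x)) * (x / (1 - x\<^sup>2)))) (at x)"
      unfolding F_def by (rule DERIV_add[OF 1 DERIV_mult[OF g 2]])
    define c where "c = x / (1 - x\<^sup>2)"
    have c: "(1 + x\<^sup>2) / (1 - x\<^sup>2)\<^sup>2 = 1 / (1 - x\<^sup>2)\<^sup>2 + c\<^sup>2" unfolding c_def using nz
      by (simp add: power_divide add_divide_distrib)
    define d where "d = 1 / (1 - x\<^sup>2)\<^sup>2"
    have "Re (Y' x * cnj (Y' x) + - q x * Y x * cnj (Y x)) +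
       ((1 + x\<^sup>2) / (1 - x\<^sup>2)\<^sup>2 * Re (Y x * cnj (Y x)) + Re (Y x * cnj (Y' x) + Y' x * cnj (Y x)) * (x / (1 - x\<^sup>2)))
       = F' x"
      unfolding F'_def c c_def[symmetric] d_def[symmetric]
      by (simp add: cmod_power2) (simp add: power2_eq_square algebra_simps)
    then show ?thesis using 3 by simp
  qed
  have F'nn: "F' x \<ge> 0" if x: "0 \<le> x" "x \<le> r" for x
  proof -
    have "x\<^sup>2 < 1" using x r by (simp add: abs_square_less_1)
    then have "cmod (q x) \<le> 1 / (1 - x\<^sup>2)\<^sup>2" using q[OF x] by (simp add: field_simps)
    then have "1 / (1 - x\<^sup>2)\<^sup>2 - Re (q x) \<ge> 0" using complex_Re_le_cmod[of "q x"] by linarith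
    then show ?thesis unfolding F'_def by (intro add_nonneg_nonneg mult_nonneg_nonneg) auto
  qed
  have "F' 0 > 0" unfolding F'_def using 0 by simp
  then obtain d where d: "d > 0" "\<And>h. 0 < h \<Longrightarrow> h < d \<Longrightarrow> F 0 < F (0 + h)"
    using DERIV_pos_inc_right[OF F[of 0]] r by auto
  define x where "x = min (d/2) r"
  have x: "0 < x" "x < d" "x \<le> r" using d r unfolding x_def by auto
  have "F x \<le> F r"
    by (rule DERIV_nonneg_imp_nondecreasing[OF x(3)]) (use F F'nn x in \<open>meson less_imp_le order_trans\<close>)
  moreover have "F 0 = 0" "F r = 0" unfolding F_def using 0 by simp_all
  ultimately show False using d(2)[of x] x by simp
qed

text \<open>
  If \<open>\<phi>\<close> takes the same value at two points, a disk automorphism moves one of them to \<open>0\<close>, and the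
  equation is restricted to the segment from \<open>0\<close> to the other. The direction \<open>u\<close> of the segment
  multiplies the potential by \<open>u\<^sup>2\<close>, which does not change its modulus.
\<close>

theorem Nehari_univalence_criterion:
  assumes \<phi>: "\<phi> holomorphic_on unit_disk" "\<And>z. z \<in> unit_disk \<Longrightarrow> deriv \<phi> z \<noteq> 0"
    and S: "\<And>z. z \<in> unit_disk \<Longrightarrow> cmod (schwarzian \<phi> z) * (1 - (cmod z)\<^sup>2)\<^sup>2 \<le> 2"
  shows "inj_on \<phi> unit_disk"
proof (rule inj_onI, rule ccontr)
  fix b c assume bc: "b \<in> unit_disk" "c \<in> unit_disk" "\<phi> b = \<phi> c" "b \<noteq> c"
  have b: "cmod b < 1" using bc by simp
  define w where "w = disk_shift (-b) c"
  have w: "cmod w < 1" unfolding w_def using disk_shift_in_disk[of "-b" c] bc by simp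
  have wc: "disk_shift b w = c" unfolding w_def using disk_shift_inverse[of b c] bc by simp
  have w0: "w \<noteq> 0" using wc disk_shift_facts(3)[OF b] bc by auto
  define \<psi> where "\<psi> z = (\<phi> \<circ> disk_shift b) z - \<phi> b" for z
  have hol: "(\<phi> \<circ> disk_shift b) holomorphic_on unit_disk" by (rule holomorphic_compose_disk_shift[OF \<phi>(1) b])
  have inD: "disk_shift b z \<in> unit_disk" if "z \<in> unit_disk" for z using disk_shift_facts(2)[OF b] that by blast
  have \<psi>h: "\<psi> holomorphic_on unit_disk" unfolding \<psi>_def by (intro holomorphic_intros hol)
  have \<psi>d: "deriv \<psi> z = deriv (\<phi> \<circ> disk_shift b) z" if "z \<in> unit_disk" for z
    unfolding \<psi>_def using holomorphic_on_imp_differentiable_at[OF hol open_ball that] by (simp add: o_def)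
  have \<psi>d0: "deriv \<psi> z \<noteq> 0" if z: "z \<in> unit_disk" for z
    unfolding \<psi>d[OF z] deriv_compose_disk_shift[OF \<phi>(1) b z] using \<phi>(2) inD z disk_shift_facts(5)[OF b] by simp
  have S\<psi>: "schwarzian \<psi> z = schwarzian (\<phi> \<circ> disk_shift b) z" if z: "z \<in> unit_disk" for z
  proof -
    have "pre_schwarzian \<psi> v = pre_schwarzian (\<phi> \<circ> disk_shift b) v" if v: "v \<in> unit_disk" for v
      using deriv_eq_on_open[OF open_ball v \<psi>d] by (simp add: pre_schwarzian_def \<psi>d[OF v])
    then show ?thesis unfolding schwarzian_def using deriv_eq_on_open[OF open_ball z] z by metis
  qed
  have bound: "cmod (schwarzian \<psi> z / 2) * (1 - (cmod z)\<^sup>2)\<^sup>2 \<le> 1" if z: "z \<in> unit_disk" for z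
  proof -
    have "schwarzian \<psi> z = schwarzian \<phi> (disk_shift b z) * (deriv (disk_shift b) z)\<^sup>2"
      using S\<psi>[OF z] schwarzian_compose_disk_shift[OF \<phi>(1) _ b z] \<phi>(2) by simp
    then have "cmod (schwarzian \<psi> z) * (1 - (cmod z)\<^sup>2)\<^sup>2
        = cmod (schwarzian \<phi> (disk_shift b z)) * (cmod (deriv (disk_shift b) z) * (1 - (cmod z)\<^sup>2))\<^sup>2"
      by (simp add: norm_mult norm_power power_mult_distrib)
    also have "\<dots> \<le> 2" unfolding disk_shift_facts(6)[OF b z] by (rule S[OF inD[OF z]])
    finally show ?thesis by (simp add: norm_divide)
  qed
  obtain y y' where y: "\<And>z. z \<in> unit_disk \<Longrightarrow> (y has_field_derivative y' z) (at z)"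
    "\<And>z. z \<in> unit_disk \<Longrightarrow> (y' has_field_derivative - (schwarzian \<psi> z / 2) * y z) (at z)"
    "\<And>z. z \<in> unit_disk \<Longrightarrow> \<psi> z = 0 \<longleftrightarrow> y z = 0"
    "\<And>z. z \<in> unit_disk \<Longrightarrow> y z = 0 \<Longrightarrow> y' z \<noteq> 0"
    using schwarzian_linear_ode[OF \<psi>h \<psi>d0] by blast
  define r where "r = cmod w"
  define u where "u = w / of_real r"
  have r: "0 < r" "r < 1" and u: "cmod u = 1" "of_real r * u = w" using w w0 unfolding r_def u_def by (auto simp: norm_divide)
  define p where "p x = of_real x * u" for x :: real
  have pD: "p x \<in> unit_disk" "cmod (p x) = x" if "0 \<le> x" "x \<le> r" for x
    using that r u unfolding p_def by (auto simp: norm_mult)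
  have p': "(p has_vector_derivative u) (at x)" for x
    unfolding p_def by (auto intro!: derivative_eq_intros)
  have chain: "((\<lambda>x. f (p x)) has_vector_derivative u * D) (at x)" if "(f has_field_derivative D) (at (p x))" for f D x
    using field_vector_diff_chain_at[OF p' that] by (simp add: o_def)
  show False
  proof (rule Nehari_ode_no_two_zeros[OF r, of "\<lambda>x. y (p x)" "\<lambda>x. u * y' (p x)" "\<lambda>x. u\<^sup>2 * (schwarzian \<psi> (p x) / 2)"])
    fix x assume x: "0 \<le> x" "x \<le> r"
    show "((\<lambda>x. y (p x)) has_vector_derivative u * y' (p x)) (at x)" by (rule chain[OF y(1)[OF pD(1)[OF x]]])
    show "((\<lambda>x. u * y' (p x)) has_vector_derivative - (u\<^sup>2 * (schwarzian \<psi> (p x) / 2)) * y (p x)) (at x)"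
      using has_vector_derivative_mult_right[OF chain[OF y(2)[OF pD(1)[OF x]]], of u]
      by (simp add: power2_eq_square algebra_simps)
    show "cmod (u\<^sup>2 * (schwarzian \<psi> (p x) / 2)) * (1 - x\<^sup>2)\<^sup>2 \<le> 1"
      using bound[OF pD(1)[OF x]] pD(2)[OF x] u by (simp add: norm_mult norm_power)
  next
    have p0: "p 0 = 0" "p r = w" using u unfolding p_def by auto
    have "\<psi> 0 = 0" "\<psi> w = 0" unfolding \<psi>_def using wc bc disk_shift_facts(3)[OF b] by simp_all
    then show "y (p 0) = 0" "u * y' (p 0) \<noteq> 0" "y (p r) = 0"
      unfolding p0 using y(3,4)[of 0] y(3)[of w] w u by auto
  qed
qed

section \<open>Affine and Moebius invariance of the harmonic Schwarzian\<close>

text \<open>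
  The analytic and coanalytic parts of \<open>f = h + cnj \<circ> g\<close> are treated as a pair, because both the affine
  changes \<open>f + a \<cdot> cnj f\<close> and the disk automorphisms act on pairs without leaving the holomorphic
  functions.
\<close>

definition sense_preserving_pair :: "(complex \<Rightarrow> complex) \<Rightarrow> (complex \<Rightarrow> complex) \<Rightarrow> bool" where
  "sense_preserving_pair h g \<longleftrightarrow> h holomorphic_on unit_disk \<and> g holomorphic_on unit_disk \<and>
     (\<forall>z\<in>unit_disk. cmod (deriv g z) < cmod (deriv h z))"

definition dil :: "(complex \<Rightarrow> complex) \<Rightarrow> (complex \<Rightarrow> complex) \<Rightarrow> complex \<Rightarrow> complex" where
  "dil h g z = deriv g z / deriv h z"

text \<open>
  The Schwarzian \<open>S\<^sub>f(z)\<close> is the classical Schwarzian at \<open>z\<close> of the holomorphic function \<open>h + a g\<close>, where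
  \<open>a = - cnj (\<omega>(z))\<close> is the coefficient for which the affine change \<open>f + a \<cdot> cnj f\<close> has dilatation zero
  at \<open>z\<close>. With this form both invariance properties reduce to the classical ones.
  The explicit formula is recovered in \<open>pair_schwarzian_formula\<close>.
\<close>

definition pair_schwarzian :: "(complex \<Rightarrow> complex) \<Rightarrow> (complex \<Rightarrow> complex) \<Rightarrow> complex \<Rightarrow> complex" where
  "pair_schwarzian h g z = schwarzian (\<lambda>w. h w + - cnj (dil h g z) * g w) z"

definition pair_schwarzian_le :: "real \<Rightarrow> (complex \<Rightarrow> complex) \<Rightarrow> (complex \<Rightarrow> complex) \<Rightarrow> bool" where
  "pair_schwarzian_le \<delta> h g \<longleftrightarrow> sense_preserving_pair h g \<and>
     (\<forall>z\<in>unit_disk. cmod (pair_schwarzian h g z) * (1 - (cmod z)\<^sup>2)\<^sup>2 \<le> \<delta>)"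

lemma sense_preserving_pairD:
  assumes "sense_preserving_pair h g"
  shows "h holomorphic_on unit_disk" "g holomorphic_on unit_disk"
    and "\<And>z. z \<in> unit_disk \<Longrightarrow> deriv h z \<noteq> 0"
    and "\<And>z. z \<in> unit_disk \<Longrightarrow> cmod (dil h g z) < 1"
    and "dil h g holomorphic_on unit_disk"
    and "\<And>z. z \<in> unit_disk \<Longrightarrow> deriv g z = deriv h z * dil h g z"
proof -
  show hg: "h holomorphic_on unit_disk" "g holomorphic_on unit_disk"
    using assms unfolding sense_preserving_pair_def by auto
  have lt: "cmod (deriv g z) < cmod (deriv h z)" if "z \<in> unit_disk" for z
    using assms that unfolding sense_preserving_pair_def by blast
  show nz: "deriv h z \<noteq> 0" if "z \<in> unit_disk" for z using lt[OF that] by auto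
  show "cmod (dil h g z) < 1" if "z \<in> unit_disk" for z
    using lt[OF that] nz[OF that] by (simp add: dil_def norm_divide)
  show "dil h g holomorphic_on unit_disk"
    unfolding dil_def[abs_def] by (intro holomorphic_intros hg nz open_ball)
  show "deriv g z = deriv h z * dil h g z" if "z \<in> unit_disk" for z
    using nz[OF that] by (simp add: dil_def)
qed

lemma one_plus_mult_nonzero:
  fixes a w :: complex
  assumes "cmod a \<le> 1" "cmod w < 1" shows "1 + a * w \<noteq> 0"
proof
  assume "1 + a * w = 0"
  then have "cmod (a * w) = 1" by (metis add_eq_0_iff norm_minus_cancel norm_one)
  moreover have "cmod (a * w) \<le> 1 * cmod w" unfolding norm_mult using assms by (intro mult_right_mono) auto
  ultimately show False using assms by simp
qed

lemma deriv_affine_combination: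
  assumes "sense_preserving_pair h g" "z \<in> unit_disk"
  shows "deriv (\<lambda>w. c * h w + a * g w) z = deriv h z * (c + a * dil h g z)"
proof -
  have "h field_differentiable at z" "g field_differentiable at z"
    using sense_preserving_pairD(1,2)[OF assms(1)] assms(2) by (auto intro: holomorphic_on_imp_differentiable_at)
  then show ?thesis using sense_preserving_pairD(6)[OF assms] by (simp add: field_differentiable_mult algebra_simps)
qed

lemma combination_locally_univalent:
  assumes hg: "sense_preserving_pair h g" and a: "cmod a \<le> 1"
  shows "(\<lambda>w. h w + a * g w) holomorphic_on unit_disk"
    and "z \<in> unit_disk \<Longrightarrow> deriv (\<lambda>w. h w + a * g w) z = deriv h z * (1 + a * dil h g z)"
    and "z \<in> unit_disk \<Longrightarrow> deriv (\<lambda>w. h w + a * g w) z \<noteq> 0"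
proof -
  show "(\<lambda>w. h w + a * g w) holomorphic_on unit_disk"
    by (intro holomorphic_intros sense_preserving_pairD[OF hg])
  show "z \<in> unit_disk \<Longrightarrow> deriv (\<lambda>w. h w + a * g w) z = deriv h z * (1 + a * dil h g z)"
    using deriv_affine_combination[OF hg, of z 1 a] by simp
  then show "z \<in> unit_disk \<Longrightarrow> deriv (\<lambda>w. h w + a * g w) z \<noteq> 0"
    using sense_preserving_pairD(3,4)[OF hg, of z] one_plus_mult_nonzero[OF a, of "dil h g z"] by simp
qed

lemma schwarzian_combination:
  assumes hg: "sense_preserving_pair h g" and a: "cmod a \<le> 1" and z: "z \<in> unit_disk"
  defines "\<omega> \<equiv> dil h g"
  shows "schwarzian (\<lambda>w. h w + a * g w) z = schwarzian h z
     - a / (1 + a * \<omega> z) * (pre_schwarzian h z * deriv \<omega> z - deriv (deriv \<omega>) z)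
     - 3/2 * (a * deriv \<omega> z / (1 + a * \<omega> z))\<^sup>2"
proof -
  note hol = sense_preserving_pairD[OF hg]
  have \<omega>: "\<omega> holomorphic_on unit_disk" using hol(5) \<omega>_def by simp
  have d1: "(\<omega> has_field_derivative deriv \<omega> w) (at w)" if "w \<in> unit_disk" for w
    using holomorphic_derivI[OF \<omega> open_ball that] .
  have d2: "(deriv \<omega> has_field_derivative deriv (deriv \<omega>) w) (at w)" if "w \<in> unit_disk" for w
    using holomorphic_derivI[OF holomorphic_deriv[OF \<omega> open_ball] open_ball that] .
  have nz: "1 + a * \<omega> w \<noteq> 0" if "w \<in> unit_disk" for w
    using one_plus_mult_nonzero[OF a hol(4)[OF that]] \<omega>_def by simp
  have dk: "((\<lambda>w. 1 + a * \<omega> w) has_field_derivative a * deriv \<omega> w) (at w)" if "w \<in> unit_disk" for w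
    using DERIV_add[OF DERIV_const DERIV_cmult[OF d1[OF that]]] by simp
  have pre: "pre_schwarzian (\<lambda>w. h w + a * g w) w = pre_schwarzian h w + a * deriv \<omega> w / (1 + a * \<omega> w)"
    if w: "w \<in> unit_disk" for w
    by (rule pre_schwarzian_multiplier[OF open_ball w _ hol(1) hol(3)[OF w] dk[OF w] nz[OF w]])
       (use combination_locally_univalent(2)[OF hg a] \<omega>_def in blast)
  have P: "(pre_schwarzian h has_field_derivative deriv (pre_schwarzian h) z) (at z)"
    using holomorphic_derivI[OF pre_schwarzian_holomorphic[OF hol(1) open_ball hol(3)] open_ball z] .
  have D: "((\<lambda>w. pre_schwarzian h w + a * deriv \<omega> w / (1 + a * \<omega> w)) has_field_derivative
      deriv (pre_schwarzian h) z + (a * deriv (deriv \<omega>) z * (1 + a * \<omega> z) - a * deriv \<omega> z * (a * deriv \<omega> z)) /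
        ((1 + a * \<omega> z) * (1 + a * \<omega> z))) (at z)"
    by (rule DERIV_add[OF P DERIV_divide[OF DERIV_cmult[OF d2[OF z]] dk[OF z] nz[OF z]]])
  define k where "k = inverse (1 + a * \<omega> z)"
  have k: "(a * deriv (deriv \<omega>) z * (1 + a * \<omega> z) - a * deriv \<omega> z * (a * deriv \<omega> z)) /
        ((1 + a * \<omega> z) * (1 + a * \<omega> z)) = a * deriv (deriv \<omega>) z * k - (a * deriv \<omega> z * k)\<^sup>2"
  proof -
    have "(1 + a * \<omega> z) * k = 1" unfolding k_def using nz[OF z] by simp
    then have "a * deriv (deriv \<omega>) z * (1 + a * \<omega> z) * (k * k) = a * deriv (deriv \<omega>) z * k"
      by (metis mult.assoc mult.left_commute mult_1)
    then show ?thesis unfolding divide_inverse inverse_mult_distrib k_def[symmetric]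
      by (simp add: power2_eq_square algebra_simps)
  qed
  have "schwarzian (\<lambda>w. h w + a * g w) z = deriv (pre_schwarzian h) z + (a * deriv (deriv \<omega>) z * k - (a * deriv \<omega> z * k)\<^sup>2)
       - 1/2 * (pre_schwarzian h z + a * deriv \<omega> z * k)\<^sup>2"
  proof -
    have "schwarzian (\<lambda>w. h w + a * g w) z = (deriv (pre_schwarzian h) z + (a * deriv (deriv \<omega>) z * k - (a * deriv \<omega> z * k)\<^sup>2))
       - 1/2 * (pre_schwarzian h z + a * deriv \<omega> z / (1 + a * \<omega> z))\<^sup>2"
      by (rule schwarzian_eqI[OF open_ball z _ D[unfolded k]]) (rule pre)
    then show ?thesis by (simp only: k_def divide_inverse)
  qed
  then show ?thesis unfolding schwarzian_def[of h] divide_inverse[of _ "1 + a * \<omega> z"] k_def[symmetric]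
    by algebra
qed

lemma pair_schwarzian_formula:
  assumes hg: "sense_preserving_pair h g" and z: "z \<in> unit_disk"
  defines "\<omega> \<equiv> dil h g"
  shows "pair_schwarzian h g z = schwarzian h z
     + cnj (\<omega> z) / (1 - cnj (\<omega> z) * \<omega> z) * (pre_schwarzian h z * deriv \<omega> z - deriv (deriv \<omega>) z)
     - 3/2 * (cnj (\<omega> z) * deriv \<omega> z / (1 - cnj (\<omega> z) * \<omega> z))\<^sup>2"
  using schwarzian_combination[OF hg _ z, of "- cnj (dil h g z)"] sense_preserving_pairD(4)[OF hg z]
  unfolding pair_schwarzian_def \<omega>_def by (simp add: less_imp_le power2_eq_square)

text \<open>
  The functions \<open>H + b G\<close> and \<open>h + \<epsilon> g\<close> are proportional when \<open>\<epsilon> = (a + b) / (1 + b \<cdot> cnj a)\<close>. The value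
  \<open>b\<close> that enters \<open>S\<^sub>F(z)\<close> corresponds under this relation to the value \<open>\<epsilon>\<close> that enters \<open>S\<^sub>f(z)\<close>.
\<close>

lemma affine_invariance:
  assumes hg: "sense_preserving_pair h g" and a: "cmod a < 1"
  defines "H \<equiv> \<lambda>w. h w + a * g w" and "G \<equiv> \<lambda>w. g w + cnj a * h w"
  shows "sense_preserving_pair H G"
    and "z \<in> unit_disk \<Longrightarrow> dil H G z = (dil h g z + cnj a) / (1 + a * dil h g z)"
    and "z \<in> unit_disk \<Longrightarrow> pair_schwarzian H G z = pair_schwarzian h g z"
    and "z \<in> unit_disk \<Longrightarrow> cmod \<epsilon> \<le> 1 \<Longrightarrow> cmod b \<le> 1 \<Longrightarrow> a + b = \<epsilon> * (1 + b * cnj a) \<Longrightarrow>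
      schwarzian (\<lambda>w. H w + b * G w) z = schwarzian (\<lambda>w. h w + \<epsilon> * g w) z"
proof -
  note hol = sense_preserving_pairD[OF hg]
  have a1: "cmod a \<le> 1" using a by simp
  have dH: "deriv H z = deriv h z * (1 + a * dil h g z)" if "z \<in> unit_disk" for z
    using combination_locally_univalent(2)[OF hg a1 that] H_def by simp
  have dG: "deriv G z = deriv h z * (dil h g z + cnj a)" if "z \<in> unit_disk" for z
    using deriv_affine_combination[OF hg that, of "cnj a" 1] G_def by (simp add: add.commute)
  have lt: "cmod (dil h g z + cnj a) < cmod (1 + a * dil h g z)" if "z \<in> unit_disk" for z
  proof -
    have "(cmod (1 + a * dil h g z))\<^sup>2 - (cmod (dil h g z + cnj a))\<^sup>2 = (1 - (cmod a)\<^sup>2) * (1 - (cmod (dil h g z))\<^sup>2)"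
      by (simp add: cmod_power2) (simp add: power2_eq_square algebra_simps)
    moreover have "\<dots> > 0" using a hol(4)[OF that] by (intro mult_pos_pos) (auto simp: abs_square_less_1)
    ultimately have "(cmod (dil h g z + cnj a))\<^sup>2 < (cmod (1 + a * dil h g z))\<^sup>2" by linarith
    then show ?thesis by (rule power2_less_imp_less) simp
  qed
  show HG: "sense_preserving_pair H G"
    unfolding sense_preserving_pair_def
  proof (intro conjI ballI)
    show "H holomorphic_on unit_disk" "G holomorphic_on unit_disk"
      unfolding H_def G_def by (intro holomorphic_intros hol)+
    show "cmod (deriv G z) < cmod (deriv H z)" if "z \<in> unit_disk" for z
      unfolding dH[OF that] dG[OF that] norm_mult using lt[OF that] hol(3)[OF that] by simp
  qed
  show dil: "dil H G z = (dil h g z + cnj a) / (1 + a * dil h g z)" if "z \<in> unit_disk" for z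
    unfolding dil_def[of H G] dH[OF that] dG[OF that] using hol(3)[OF that] by simp
  show comb: "schwarzian (\<lambda>w. H w + b * G w) z = schwarzian (\<lambda>w. h w + \<epsilon> * g w) z"
    if z: "z \<in> unit_disk" and e: "cmod \<epsilon> \<le> 1" and b: "cmod b \<le> 1" and eq: "a + b = \<epsilon> * (1 + b * cnj a)" for \<epsilon> b z
  proof -
    have "1 + b * cnj a \<noteq> 0" using one_plus_mult_nonzero[OF b, of "cnj a"] a by simp
    moreover have "(\<lambda>w. H w + b * G w) = (\<lambda>w. (1 + b * cnj a) * (h w + \<epsilon> * g w))"
    proof
      fix w
      have "H w + b * G w = (1 + b * cnj a) * h w + (a + b) * g w"
        unfolding H_def G_def by (simp add: algebra_simps)
      then show "H w + b * G w = (1 + b * cnj a) * (h w + \<epsilon> * g w)" unfolding eq by (simp add: algebra_simps)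
    qed
    ultimately show ?thesis
      using schwarzian_scale[OF open_ball z combination_locally_univalent(1,3)[OF hg e]] by simp
  qed
  show "pair_schwarzian H G z = pair_schwarzian h g z" if z: "z \<in> unit_disk" for z
    unfolding pair_schwarzian_def
  proof (rule comb[OF z])
    show "cmod (- cnj (dil h g z)) \<le> 1" "cmod (- cnj (dil H G z)) \<le> 1"
      using hol(4)[OF z] sense_preserving_pairD(4)[OF HG z] by auto
    have "1 + a * dil h g z \<noteq> 0" by (rule one_plus_mult_nonzero[OF a1 hol(4)[OF z]])
    then have "cnj (1 + a * dil h g z) \<noteq> 0" by (metis complex_cnj_zero_iff)
    then have "1 + cnj a * cnj (dil h g z) \<noteq> 0" by simp
    then show "a + - cnj (dil H G z) = - cnj (dil h g z) * (1 + - cnj (dil H G z) * cnj a)"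
      unfolding dil[OF z] by (simp add: field_simps)
  qed
qed

lemma disk_shift_invariance:
  assumes hg: "sense_preserving_pair h g" and b: "cmod b < 1" and z: "z \<in> unit_disk"
  defines "H \<equiv> h \<circ> disk_shift b" and "G \<equiv> g \<circ> disk_shift b"
  shows "dil H G z = dil h g (disk_shift b z)"
    and "cmod a \<le> 1 \<Longrightarrow> schwarzian (\<lambda>w. H w + a * G w) z =
           schwarzian (\<lambda>w. h w + a * g w) (disk_shift b z) * (deriv (disk_shift b) z)\<^sup>2"
    and "pair_schwarzian H G z = pair_schwarzian h g (disk_shift b z) * (deriv (disk_shift b) z)\<^sup>2"
    and "cmod (deriv G z) < cmod (deriv H z)"
proof -
  note hol = sense_preserving_pairD[OF hg]
  have inD: "disk_shift b z \<in> unit_disk" using disk_shift_facts(2)[OF b] z by blast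
  note dH = deriv_compose_disk_shift[OF hol(1) b z] and dG = deriv_compose_disk_shift[OF hol(2) b z]
  show dil: "dil H G z = dil h g (disk_shift b z)"
    unfolding dil_def H_def G_def dH dG using disk_shift_facts(5)[OF b z] by simp
  show comb: "schwarzian (\<lambda>w. H w + a * G w) z =
           schwarzian (\<lambda>w. h w + a * g w) (disk_shift b z) * (deriv (disk_shift b) z)\<^sup>2" if "cmod a \<le> 1" for a
    using schwarzian_compose_disk_shift[OF combination_locally_univalent(1)[OF hg that] _ b z]
      combination_locally_univalent(3)[OF hg that] unfolding H_def G_def by (simp add: o_def)
  show "pair_schwarzian H G z = pair_schwarzian h g (disk_shift b z) * (deriv (disk_shift b) z)\<^sup>2"
    unfolding pair_schwarzian_def dil by (rule comb) (use hol(4)[OF inD] in simp)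
  have "cmod (deriv g (disk_shift b z)) < cmod (deriv h (disk_shift b z))"
    using hg inD unfolding sense_preserving_pair_def by blast
  then show "cmod (deriv G z) < cmod (deriv H z)"
    unfolding H_def G_def dH dG norm_mult using disk_shift_facts(5)[OF b z] by simp
qed

lemma pair_schwarzian_le_disk_shift:
  assumes hg: "pair_schwarzian_le \<delta> h g" and b: "cmod b < 1"
  shows "pair_schwarzian_le \<delta> (h \<circ> disk_shift b) (g \<circ> disk_shift b)"
proof -
  have sp: "sense_preserving_pair h g" using hg unfolding pair_schwarzian_le_def by blast
  note inv = disk_shift_invariance[OF sp b]
  have "cmod (pair_schwarzian (h \<circ> disk_shift b) (g \<circ> disk_shift b) z) * (1 - (cmod z)\<^sup>2)\<^sup>2 \<le> \<delta>"
    if z: "z \<in> unit_disk" for z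
  proof -
    have "cmod (pair_schwarzian (h \<circ> disk_shift b) (g \<circ> disk_shift b) z) * (1 - (cmod z)\<^sup>2)\<^sup>2
      = cmod (pair_schwarzian h g (disk_shift b z)) * (cmod (deriv (disk_shift b) z) * (1 - (cmod z)\<^sup>2))\<^sup>2"
      using inv(3)[OF z] by (simp add: norm_mult norm_power power_mult_distrib)
    also have "\<dots> \<le> \<delta>" unfolding disk_shift_facts(6)[OF b z]
      using hg disk_shift_facts(2)[OF b] z unfolding pair_schwarzian_le_def by blast
    finally show ?thesis .
  qed
  then show ?thesis unfolding pair_schwarzian_le_def sense_preserving_pair_def
    using inv(4) holomorphic_compose_disk_shift[OF _ b] sense_preserving_pairD(1,2)[OF sp] by blast
qed

lemma pair_schwarzian_le_affine:
  assumes "pair_schwarzian_le \<delta> h g" "cmod a < 1"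
  shows "pair_schwarzian_le \<delta> (\<lambda>w. h w + a * g w) (\<lambda>w. g w + cnj a * h w)"
  using assms affine_invariance(1,3)[of h g a] unfolding pair_schwarzian_le_def by auto

text \<open>
  An affine change kills the dilatation at \<open>z\<close> and a disk automorphism then moves \<open>z\<close> to \<open>0\<close>. Unimodular
  coefficients \<open>\<epsilon>\<close> are permuted, since \<open>\<epsilon> \<mapsto> (\<epsilon> - a) / (1 - \<epsilon> \<cdot> cnj a)\<close> preserves the unit circle. This lets
  every pointwise estimate be proved at the origin with \<open>\<omega>(0) = 0\<close>.
\<close>

lemma normalization_at_point:
  assumes sp: "sense_preserving_pair h g" and z: "z \<in> unit_disk"
  shows "\<exists>H G. sense_preserving_pair H G \<and> (\<forall>\<delta>. pair_schwarzian_le \<delta> h g \<longrightarrow> pair_schwarzian_le \<delta> H G) \<and> dil H G 0 = 0 \<and>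
    cmod (deriv (dil H G) 0) = cmod (deriv (dil h g) z) * (1 - (cmod z)\<^sup>2) / (1 - (cmod (dil h g z))\<^sup>2) \<and>
    (\<forall>\<epsilon>. cmod \<epsilon> = 1 \<longrightarrow> (\<exists>b. cmod b = 1 \<and>
       cmod (schwarzian (\<lambda>w. h w + \<epsilon> * g w) z) * (1 - (cmod z)\<^sup>2)\<^sup>2 = cmod (schwarzian (\<lambda>w. H w + b * G w) 0)))"
proof -
  note hol = sense_preserving_pairD[OF sp]
  define a where "a = - cnj (dil h g z)"
  have a: "cmod a < 1" using hol(4)[OF z] unfolding a_def by simp
  have z1: "cmod z < 1" using z by simp
  have 0: "0 \<in> unit_disk" by simp
  define h1 where "h1 w = h w + a * g w" for w
  define g1 where "g1 w = g w + cnj a * h w" for w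
  have sp1: "sense_preserving_pair h1 g1" using affine_invariance(1)[OF sp a] unfolding h1_def g1_def .
  have dil1: "dil h1 g1 w = (dil h g w + cnj a) / (1 + a * dil h g w)" if "w \<in> unit_disk" for w
    using affine_invariance(2)[OF sp a that] unfolding h1_def g1_def .
  define H where "H = h1 \<circ> disk_shift z"
  define G where "G = g1 \<circ> disk_shift z"
  have le: "pair_schwarzian_le \<delta> H G" if "pair_schwarzian_le \<delta> h g" for \<delta>
    using pair_schwarzian_le_disk_shift[OF _ z1] pair_schwarzian_le_affine[OF that a]
    unfolding H_def G_def h1_def g1_def by blast
  have spHG: "sense_preserving_pair H G"
    unfolding sense_preserving_pair_def H_def G_def
    using disk_shift_invariance(4)[OF sp1 z1] holomorphic_compose_disk_shift[OF _ z1] sense_preserving_pairD(1,2)[OF sp1] by blast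
  have dil: "dil H G w = dil h1 g1 (disk_shift z w)" if "w \<in> unit_disk" for w
    using disk_shift_invariance(1)[OF sp1 z1 that] unfolding H_def G_def .
  have p: "1 - (cmod (dil h g z))\<^sup>2 > 0" using hol(4)[OF z] by (simp add: abs_square_less_1)
  have pz: "1 - (cmod z)\<^sup>2 > 0" using z1 by (simp add: abs_square_less_1)
  have aw: "1 + a * dil h g z = of_real (1 - (cmod (dil h g z))\<^sup>2)" "1 - a * cnj a = of_real (1 - (cmod (dil h g z))\<^sup>2)"
    unfolding a_def by (simp_all add: complex_norm_square[symmetric] mult.commute)
  have d0: "deriv (disk_shift z) 0 = of_real (1 - (cmod z)\<^sup>2)"
    using disk_shift_facts(4)[OF z1 0] by (simp add: complex_norm_square[symmetric] mult.commute)
  have "dil H G 0 = 0" using dil[OF 0] disk_shift_facts(3)[OF z1] dil1[OF z] unfolding a_def by simp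
  moreover have "cmod (deriv (dil H G) 0) = cmod (deriv (dil h g) z) * (1 - (cmod z)\<^sup>2) / (1 - (cmod (dil h g z))\<^sup>2)"
  proof -
    have w': "(dil h g has_field_derivative deriv (dil h g) z) (at z)" using holomorphic_derivI[OF hol(5) open_ball z] .
    have nz: "1 + a * dil h g z \<noteq> 0" using p unfolding aw by (simp del: of_real_diff of_real_power)
    have A: "((\<lambda>w. (dil h g w + cnj a) / (1 + a * dil h g w)) has_field_derivative
        deriv (dil h g) z * (1 - a * cnj a) / (1 + a * dil h g z)\<^sup>2) (at z)"
      using nz by (auto intro!: derivative_eq_intros w' simp: field_simps power2_eq_square)
    have "deriv (dil h1 g1) z = deriv (dil h g) z * (1 - a * cnj a) / (1 + a * dil h g z)\<^sup>2"
      using deriv_eq_on_open[OF open_ball z dil1] A by (simp add: DERIV_imp_deriv)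
    also have "\<dots> = deriv (dil h g) z / of_real (1 - (cmod (dil h g z))\<^sup>2)"
      unfolding aw using p by (simp add: power2_eq_square del: of_real_diff of_real_power)
    finally have 1: "deriv (dil h1 g1) z = deriv (dil h g) z / of_real (1 - (cmod (dil h g z))\<^sup>2)" .
    have "deriv (dil H G) 0 = deriv (dil h1 g1 \<circ> disk_shift z) 0"
      using deriv_eq_on_open[OF open_ball 0] dil by (metis comp_apply)
    also have "\<dots> = deriv (dil h1 g1) z * of_real (1 - (cmod z)\<^sup>2)"
      using deriv_compose_disk_shift[OF sense_preserving_pairD(5)[OF sp1] z1 0] d0 disk_shift_facts(3)[OF z1] by simp
    finally show ?thesis unfolding 1 using p pz by (simp add: norm_mult norm_divide del: of_real_diff of_real_power)
  qed
  moreover have "\<exists>b. cmod b = 1 \<and>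
       cmod (schwarzian (\<lambda>w. h w + \<epsilon> * g w) z) * (1 - (cmod z)\<^sup>2)\<^sup>2 = cmod (schwarzian (\<lambda>w. H w + b * G w) 0)"
    if e: "cmod \<epsilon> = 1" for \<epsilon>
  proof -
    have nz: "1 - \<epsilon> * cnj a \<noteq> 0" using one_plus_mult_nonzero[of \<epsilon> "- cnj a"] e a by simp
    define b where "b = (\<epsilon> - a) / (1 - \<epsilon> * cnj a)"
    have ee: "\<epsilon> * cnj \<epsilon> = 1" using e by (simp add: complex_norm_square[symmetric])
    have "\<epsilon> * cnj (\<epsilon> - a) = 1 - \<epsilon> * cnj a" using ee by (simp add: algebra_simps)
    then have "cmod (\<epsilon> - a) = cmod (1 - \<epsilon> * cnj a)" using e by (metis complex_mod_cnj mult_1 norm_mult)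
    then have b: "cmod b = 1" unfolding b_def using nz by (simp add: norm_divide)
    have "a + b = \<epsilon> * (1 + b * cnj a)" unfolding b_def using nz by (simp add: divide_simps) (simp add: algebra_simps)
    then have "schwarzian (\<lambda>w. h1 w + b * g1 w) z = schwarzian (\<lambda>w. h w + \<epsilon> * g w) z"
      using affine_invariance(4)[OF sp a z, of \<epsilon> b] e b unfolding h1_def g1_def by simp
    moreover have "schwarzian (\<lambda>w. H w + b * G w) 0 = schwarzian (\<lambda>w. h1 w + b * g1 w) z * (of_real (1 - (cmod z)\<^sup>2))\<^sup>2"
      using disk_shift_invariance(2)[OF sp1 z1 0, of b] b unfolding H_def G_def d0 disk_shift_facts(3)[OF z1] by simp
    ultimately show ?thesis using b pz by (intro exI[of _ b]) (simp add: norm_mult norm_power del: of_real_diff of_real_power)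
  qed
  ultimately show ?thesis using le spHG by blast
qed

lemma Schwarz_Pick_dilatation:
  assumes sp: "sense_preserving_pair h g" and z: "z \<in> unit_disk"
  shows "cmod (deriv (dil h g) z) * (1 - (cmod z)\<^sup>2) \<le> 1 - (cmod (dil h g z))\<^sup>2"
proof -
  obtain H G where HG: "sense_preserving_pair H G" "dil H G 0 = 0"
    "cmod (deriv (dil H G) 0) = cmod (deriv (dil h g) z) * (1 - (cmod z)\<^sup>2) / (1 - (cmod (dil h g z))\<^sup>2)"
    using normalization_at_point[OF sp z] by blast
  have "cmod (deriv (dil H G) 0) \<le> 1"
    by (rule Schwarz_Lemma(2)[OF sense_preserving_pairD(5)[OF HG(1)] HG(2), of 0])
       (use sense_preserving_pairD(4)[OF HG(1)] in auto)
  moreover have "1 - (cmod (dil h g z))\<^sup>2 > 0"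
    using sense_preserving_pairD(4)[OF sp z] by (simp add: abs_square_less_1)
  ultimately show ?thesis unfolding HG(3) by (simp add: field_simps)
qed

section \<open>Bound for the invariant pre-Schwarzian\<close>

lemma one_minus_cnj_mult: "1 - cnj w * w = complex_of_real (1 - (cmod w)\<^sup>2)"
  by (simp add: complex_norm_square[symmetric] mult.commute)

text \<open>
  This is \<open>\<partial>\<^sub>z log J\<close> for the Jacobian \<open>J = |h'|\<^sup>2 (1 - |\<omega>|\<^sup>2)\<close>.
\<close>

definition harmonic_pre_schwarzian :: "(complex \<Rightarrow> complex) \<Rightarrow> (complex \<Rightarrow> complex) \<Rightarrow> complex \<Rightarrow> complex" where
  "harmonic_pre_schwarzian h g z = pre_schwarzian h z
     - cnj (dil h g z) * deriv (dil h g) z / (1 - cnj (dil h g z) * dil h g z)"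

text \<open>
  In terms of \<open>\<rho> = log J\<close> and \<open>Q = \<rho>\<^sub>z\<close>, the Schwarzian is \<open>S\<^sub>f = Q\<^sub>z - Q\<^sup>2/2\<close>, and the failure of \<open>Q\<close> to
  be holomorphic is \<open>Q\<^bsub>z'\<^esub> = - (|\<omega>'| / (1 - |\<omega>|\<^sup>2))\<^sup>2\<close>, where \<open>z'\<close> stands for \<open>cnj z\<close>. The latter is bounded
  by the Schwarz--Pick lemma no matter what \<open>S\<^sub>f\<close> is.
\<close>

lemma harmonic_pre_schwarzian_derivative:
  assumes sp: "sense_preserving_pair h g" and z: "z \<in> unit_disk"
  defines "\<omega> \<equiv> dil h g" and "Q \<equiv> harmonic_pre_schwarzian h g"
  shows "(Q has_derivative (\<lambda>v. (pair_schwarzian h g z + 1/2 * (Q z)\<^sup>2) * v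
      - of_real ((cmod (deriv \<omega> z) / (1 - (cmod (\<omega> z))\<^sup>2))\<^sup>2) * cnj v)) (at z)"
proof -
  note hol = sense_preserving_pairD[OF sp]
  have \<omega>: "\<omega> holomorphic_on unit_disk" using hol(5) \<omega>_def by simp
  have w1: "(\<omega> has_derivative (\<lambda>v. deriv \<omega> z * v)) (at z)"
    using holomorphic_derivI[OF \<omega> open_ball z] unfolding has_field_derivative_def .
  have w2: "(deriv \<omega> has_derivative (\<lambda>v. deriv (deriv \<omega>) z * v)) (at z)"
    using holomorphic_derivI[OF holomorphic_deriv[OF \<omega> open_ball] open_ball z] unfolding has_field_derivative_def .
  have P: "(pre_schwarzian h has_derivative (\<lambda>v. deriv (pre_schwarzian h) z * v)) (at z)"
    using holomorphic_derivI[OF pre_schwarzian_holomorphic[OF hol(1) open_ball hol(3)] open_ball z]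
    unfolding has_field_derivative_def .
  have cw: "((\<lambda>w. cnj (\<omega> w)) has_derivative (\<lambda>v. cnj (deriv \<omega> z * v))) (at z)"
    by (rule has_derivative_cnj[OF w1])
  have pos: "1 - (cmod (\<omega> z))\<^sup>2 > 0" using hol(4)[OF z] by (simp add: \<omega>_def abs_square_less_1)
  have nz: "1 - cnj (\<omega> z) * \<omega> z \<noteq> 0" unfolding one_minus_cnj_mult using pos by (simp del: of_real_diff of_real_power)
  define k where "k w = inverse (1 - cnj (\<omega> w) * \<omega> w)" for w
  have k: "(k has_derivative (\<lambda>v. k z * (cnj (\<omega> z) * (deriv \<omega> z * v) + cnj (deriv \<omega> z * v) * \<omega> z) * k z)) (at z)"
    unfolding k_def
    by (rule has_derivative_eq_rhs[OF Deriv.has_derivative_inverse[OF nz has_derivative_diff[OF has_derivative_const has_derivative_mult[OF cw w1]]]])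
       (simp add: algebra_simps)
  have Qeq: "Q = (\<lambda>w. pre_schwarzian h w - cnj (\<omega> w) * deriv \<omega> w * k w)"
    unfolding Q_def harmonic_pre_schwarzian_def[abs_def] k_def \<omega>_def by (simp add: divide_inverse)
  have kk: "k z = 1 / of_real (1 - (cmod (\<omega> z))\<^sup>2)" unfolding k_def one_minus_cnj_mult by (simp add: divide_inverse)
  have sig: "of_real ((cmod (deriv \<omega> z) / (1 - (cmod (\<omega> z))\<^sup>2))\<^sup>2) = deriv \<omega> z * cnj (deriv \<omega> z) * (k z)\<^sup>2"
    unfolding kk using complex_norm_square[of "deriv \<omega> z"] by (simp add: power_divide)
  have k1: "k z + k z * (cnj (\<omega> z) * \<omega> z) * k z = (k z)\<^sup>2"
  proof -
    have "k z * (1 - cnj (\<omega> z) * \<omega> z) = 1" unfolding k_def using nz by simp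
    then have "cnj (\<omega> z) * \<omega> z * k z = k z - 1" by (simp add: algebra_simps)
    then have "k z * (cnj (\<omega> z) * \<omega> z) * k z = k z * (k z - 1)" by (metis mult.assoc)
    then show ?thesis by (simp add: power2_eq_square algebra_simps)
  qed
  have S: "pair_schwarzian h g z + 1/2 * (Q z)\<^sup>2
     = deriv (pre_schwarzian h) z - cnj (\<omega> z) * deriv (deriv \<omega>) z * k z - (cnj (\<omega> z) * deriv \<omega> z * k z)\<^sup>2"
    unfolding pair_schwarzian_formula[OF sp z] schwarzian_def Qeq \<omega>_def[symmetric] divide_inverse[of _ "1 - cnj (\<omega> z) * \<omega> z"] k_def[symmetric]
    by algebra
  have D: "(Q has_derivative (\<lambda>v. deriv (pre_schwarzian h) z * v -
      ((cnj (\<omega> z) * deriv \<omega> z) * (k z * (cnj (\<omega> z) * (deriv \<omega> z * v) + cnj (deriv \<omega> z * v) * \<omega> z) * k z)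
       + (cnj (\<omega> z) * (deriv (deriv \<omega>) z * v) + cnj (deriv \<omega> z * v) * deriv \<omega> z) * k z))) (at z)"
    unfolding Qeq by (rule has_derivative_diff[OF P has_derivative_mult[OF has_derivative_mult[OF cw w2] k]])
  have rw: "deriv (pre_schwarzian h) z * v -
      ((cnj (\<omega> z) * deriv \<omega> z) * (k z * (cnj (\<omega> z) * (deriv \<omega> z * v) + cnj (deriv \<omega> z * v) * \<omega> z) * k z)
       + (cnj (\<omega> z) * (deriv (deriv \<omega>) z * v) + cnj (deriv \<omega> z * v) * deriv \<omega> z) * k z)
     = (pair_schwarzian h g z + 1/2 * (Q z)\<^sup>2) * v
      - of_real ((cmod (deriv \<omega> z) / (1 - (cmod (\<omega> z))\<^sup>2))\<^sup>2) * cnj v" for v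
    unfolding S sig using k1 by (simp only: complex_cnj_mult) algebra
  show ?thesis using D unfolding rw .
qed

text \<open>
  The identity behind the order bound. If \<open>A = \<rho> Q / 4 - cnj z\<close> has a critical modulus at \<open>z\<close>, then the
  derivative of \<open>|A|\<^sup>2\<close> in the direction \<open>cnj A\<close> vanishes, and after multiplication by \<open>\<rho>\<close> this reads
  \<open>|A|\<^sup>4 = |A|\<^sup>2 (1 + \<rho>\<^sup>2 \<sigma> / 8) - Re (\<rho>\<^sup>2 S (cnj A)\<^sup>2) / 8\<close>.
\<close>

lemma critical_point_bound:
  fixes A z Q S :: complex and \<rho> \<sigma> :: real
  assumes \<rho>: "of_real \<rho> = 1 - z * cnj z" and Q: "of_real \<rho> * Q = 4 * (A + cnj z)"
    and crit: "Re ((- (1/4) * (cnj A * cnj z + z * A) * Q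
        + 1/4 * of_real \<rho> * (cnj A / 2 * (S + 1/2 * Q\<^sup>2) - A / 2 * of_real \<sigma>) - A) * cnj A) = 0"
    and S: "\<rho>\<^sup>2 * cmod S \<le> s" and \<sigma>: "\<rho>\<^sup>2 * \<sigma> \<le> t" and nz: "A \<noteq> 0"
  shows "(cmod A)\<^sup>2 \<le> 1 + s/8 + t/8"
proof -
  define r where "r = complex_of_real \<rho>"
  have "r * (- (1/4) * (cnj A * cnj z + z * A) * Q
        + 1/4 * r * (cnj A / 2 * (S + 1/2 * Q\<^sup>2) - A / 2 * of_real \<sigma>) - A)
     = - (1/4) * (cnj A * cnj z + z * A) * (r * Q)
        + (r\<^sup>2 * S * cnj A / 8 + cnj A / 16 * (r * Q)\<^sup>2 - A / 8 * (r\<^sup>2 * of_real \<sigma>)) - r * A"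
    by (simp add: power2_eq_square field_simps)
  also have "\<dots> = r\<^sup>2 * S * cnj A / 8 + cnj A * A * A + A * cnj A * cnj z - z * A * A - A - A * (r\<^sup>2 * of_real \<sigma>) / 8"
    using Q[folded r_def] \<rho>[folded r_def] by algebra
  finally have eq: "r * (- (1/4) * (cnj A * cnj z + z * A) * Q
        + 1/4 * r * (cnj A / 2 * (S + 1/2 * Q\<^sup>2) - A / 2 * of_real \<sigma>) - A)
     = r\<^sup>2 * S * cnj A / 8 + cnj A * A * A + A * cnj A * cnj z - z * A * A - A - A * (r\<^sup>2 * of_real \<sigma>) / 8" .
  define N where "N = (cmod A)\<^sup>2"
  have N: "A * cnj A = of_real N" unfolding N_def by (rule complex_norm_square[symmetric])
  have "0 = Re (r * (- (1/4) * (cnj A * cnj z + z * A) * Q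
        + 1/4 * r * (cnj A / 2 * (S + 1/2 * Q\<^sup>2) - A / 2 * of_real \<sigma>) - A) * cnj A)"
  proof -
    have "Re (complex_of_real \<rho> * X * cnj A) = \<rho> * Re (X * cnj A)" for X by (simp add: algebra_simps)
    then show ?thesis unfolding r_def by (simp only: crit mult_zero_right)
  qed
  also have "\<dots> = Re (r\<^sup>2 * S * (cnj A * cnj A) / 8 + of_real N * of_real N + (of_real N * (cnj z * cnj A) - of_real N * (z * A)) - of_real N - of_real N * (r\<^sup>2 * of_real \<sigma>) / 8)"
    unfolding eq N[symmetric] by (rule arg_cong[of _ _ Re]) (simp add: algebra_simps)
  also have "\<dots> = Re (r\<^sup>2 * S * (cnj A * cnj A) / 8) + N\<^sup>2 - N - N * (\<rho>\<^sup>2 * \<sigma>) / 8"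
    unfolding r_def by (simp add: power2_eq_square del: Re_divide_numeral)
  finally have e: "N\<^sup>2 = N + N * (\<rho>\<^sup>2 * \<sigma>) / 8 - Re (r\<^sup>2 * S * (cnj A * cnj A) / 8)" by linarith
  have "- Re (r\<^sup>2 * S * (cnj A * cnj A) / 8) \<le> cmod (r\<^sup>2 * S * (cnj A * cnj A) / 8)"
    using abs_Re_le_cmod by (metis abs_le_D2)
  also have "\<dots> = \<rho>\<^sup>2 * cmod S * N / 8"
    unfolding r_def N_def by (simp add: norm_mult norm_divide norm_power power2_eq_square)
  also have "\<dots> \<le> s * N / 8" using S unfolding N_def by (intro divide_right_mono mult_right_mono) auto
  finally have 1: "- Re (r\<^sup>2 * S * (cnj A * cnj A) / 8) \<le> s * N / 8" .
  have 2: "N * (\<rho>\<^sup>2 * \<sigma>) \<le> N * t" using \<sigma> unfolding N_def by (intro mult_left_mono) auto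
  have "N * N \<le> N * (1 + s/8 + t/8)"
  proof -
    have "N * N = N\<^sup>2" "N * (1 + s/8 + t/8) = N + s * N / 8 + N * t / 8"
      by (simp_all add: power2_eq_square algebra_simps)
    then show ?thesis using e 1 2 by linarith
  qed
  moreover have "N > 0" using nz unfolding N_def by simp
  ultimately show ?thesis unfolding N_def[symmetric] by (simp add: mult_le_cancel_left)
qed

text \<open>
  The quantity \<open>A\<close> is, up to rotation, half the pre-Schwarzian at the origin of the dilation
  \<open>z \<mapsto> f (z/2)\<close> renormalized at \<open>z\<close>, that is, the second coefficient whose supremum is the order of
  a linearly invariant family. The dilation makes \<open>A\<close> continuous up to the unit circle, where \<open>|A| = 1\<close>.
  Any larger value of \<open>|A|\<close> is therefore dominated by an interior maximum, where the identity above
  applies.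
\<close>

lemma harmonic_order_bound:
  assumes le: "pair_schwarzian_le 1 h g" and z: "cmod z \<le> 1"
  defines "A \<equiv> \<lambda>z. 1/4 * (1 - z * cnj z) * harmonic_pre_schwarzian h g (z / 2) - cnj z"
  shows "(cmod (A z))\<^sup>2 \<le> 5/4"
proof -
  let ?Q = "harmonic_pre_schwarzian h g"
  have sp: "sense_preserving_pair h g" using le unfolding pair_schwarzian_le_def by blast
  have half: "z / 2 \<in> unit_disk" if "cmod z \<le> 1" for z :: complex using that by (simp add: norm_divide)
  define \<sigma> where "\<sigma> w = (cmod (deriv (dil h g) w) / (1 - (cmod (dil h g w))\<^sup>2))\<^sup>2" for w
  define L where "L w v = (pair_schwarzian h g w + 1/2 * (?Q w)\<^sup>2) * v - of_real (\<sigma> w) * cnj v" for w v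
  have QD: "(?Q has_derivative L w) (at w)" if "w \<in> unit_disk" for w
    using harmonic_pre_schwarzian_derivative[OF sp that] unfolding L_def \<sigma>_def .
  have h2: "((\<lambda>z. z / 2) has_derivative (\<lambda>v. v / 2)) (at z)" for z :: complex
    by (auto intro!: derivative_eq_intros)
  have Q2: "((\<lambda>z. ?Q (z / 2)) has_derivative (\<lambda>v. L (z / 2) (v / 2))) (at z)" if "cmod z \<le> 1" for z
    by (rule has_derivative_compose[OF h2 QD[OF half[OF that]]])
  have R: "((\<lambda>z. 1/4 * (1 - z * cnj z)) has_derivative (\<lambda>v. - (1/4) * (z * cnj v + v * cnj z))) (at z)" for z
    by (auto intro!: derivative_eq_intros simp: field_simps)
  have AD: "(A has_derivative (\<lambda>v. (1/4 * (1 - z * cnj z)) * L (z / 2) (v / 2)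
        + - (1/4) * (z * cnj v + v * cnj z) * ?Q (z / 2) - cnj v)) (at z)" if "cmod z \<le> 1" for z
    unfolding A_def
    by (rule has_derivative_diff[OF has_derivative_mult[OF R Q2[OF that]] has_derivative_cnj[OF has_derivative_ident]])
  define N where "N z = Re (A z * cnj (A z))" for z
  have N: "N z = (cmod (A z))\<^sup>2" for z unfolding N_def cmod_power2 by (simp add: power2_eq_square)
  define A' where "A' z v = (1/4 * (1 - z * cnj z)) * L (z / 2) (v / 2)
        + - (1/4) * (z * cnj v + v * cnj z) * ?Q (z / 2) - cnj v" for z v
  have ND: "(N has_derivative (\<lambda>v. Re (A z * cnj (A' z v) + A' z v * cnj (A z)))) (at z)" if "cmod z \<le> 1" for z
    unfolding N_def A'_def
    by (rule has_derivative_Re[OF has_derivative_mult[OF AD[OF that] has_derivative_cnj[OF AD[OF that]]]])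
  have "continuous_on (cball 0 1) N"
    using ND by (intro has_derivative_continuous_on[of "cball 0 1" N]) (auto intro: has_derivative_at_withinI)
  then obtain m where m: "m \<in> cball 0 1" "\<And>z. z \<in> cball 0 1 \<Longrightarrow> N z \<le> N m"
    using continuous_attains_sup[OF compact_cball, of "0::complex" 1 N] by auto
  have m1: "cmod m \<le> 1" using m by simp
  have "N m \<le> 5/4"
  proof (cases "cmod m = 1 \<or> A m = 0")
    case True
    then show ?thesis
    proof
      assume "cmod m = 1"
      then have "m * cnj m = 1" by (simp add: complex_norm_square[symmetric])
      then have "A m = - cnj m" unfolding A_def by simp
      then show ?thesis unfolding N using \<open>cmod m = 1\<close> by simp
    next
      assume "A m = 0" then show ?thesis unfolding N by simp
    qed
  next
    case False
    then have mD: "m \<in> unit_disk" using m1 by simp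
    \<comment> \<open>At an interior maximum only the derivative in the direction \<open>cnj (A m)\<close> is needed.\<close>
    have "(\<lambda>v. Re (A m * cnj (A' m v) + A' m v * cnj (A m))) = (\<lambda>v. 0)"
      by (rule differential_zero_maxmin[OF mD open_ball ND[OF m1]]) (use m(2) in auto)
    then have "Re (A m * cnj (A' m (cnj (A m))) + A' m (cnj (A m)) * cnj (A m)) = 0" by meson
    moreover have twice: "Re (A m * cnj X + X * cnj (A m)) = 2 * Re (X * cnj (A m))" for X by simp
    ultimately have "2 * Re (A' m (cnj (A m)) * cnj (A m)) = 0" by (simp only: twice)
    then have crit: "Re (A' m (cnj (A m)) * cnj (A m)) = 0" by linarith
    define \<rho> where "\<rho> = 1 - (cmod m)\<^sup>2"
    have \<rho>: "complex_of_real \<rho> = 1 - m * cnj m" unfolding \<rho>_def by (simp add: complex_norm_square[symmetric])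
    have \<rho>0: "0 \<le> \<rho>" "\<rho> \<le> 1 - (cmod (m / 2))\<^sup>2" unfolding \<rho>_def using m1
      by (auto simp: abs_square_le_1 norm_divide power_divide)
    have mh: "m / 2 \<in> unit_disk" by (rule half[OF m1])
    have S: "\<rho>\<^sup>2 * cmod (pair_schwarzian h g (m / 2)) \<le> 1"
    proof -
      have "\<rho>\<^sup>2 * cmod (pair_schwarzian h g (m / 2)) \<le> (1 - (cmod (m / 2))\<^sup>2)\<^sup>2 * cmod (pair_schwarzian h g (m / 2))"
        using \<rho>0 by (intro mult_right_mono power_mono) auto
      also have "\<dots> \<le> 1" using le mh unfolding pair_schwarzian_le_def by (metis mult.commute)
      finally show ?thesis .
    qed
    have s: "\<rho>\<^sup>2 * \<sigma> (m / 2) \<le> 1"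
    proof -
      have d: "1 - (cmod (dil h g (m / 2)))\<^sup>2 > 0"
        using sense_preserving_pairD(4)[OF sp mh] by (simp add: abs_square_less_1)
      have "\<rho> * cmod (deriv (dil h g) (m / 2)) \<le> (1 - (cmod (m / 2))\<^sup>2) * cmod (deriv (dil h g) (m / 2))"
        using \<rho>0 by (intro mult_right_mono) auto
      also have "\<dots> \<le> 1 - (cmod (dil h g (m / 2)))\<^sup>2"
        using Schwarz_Pick_dilatation[OF sp mh] by (simp add: mult.commute)
      finally have "\<rho> * (cmod (deriv (dil h g) (m / 2)) / (1 - (cmod (dil h g (m / 2)))\<^sup>2)) \<le> 1"
        using d by (simp add: field_simps)
      then have "(\<rho> * (cmod (deriv (dil h g) (m / 2)) / (1 - (cmod (dil h g (m / 2)))\<^sup>2)))\<^sup>2 \<le> 1"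
        using \<rho>0 d by (intro power_le_one) auto
      then show ?thesis unfolding \<sigma>_def power_mult_distrib .
    qed
    have "(cmod (A m))\<^sup>2 \<le> 1 + 1/8 + 1/8"
    proof (rule critical_point_bound[OF \<rho> _ _ S s])
      show "complex_of_real \<rho> * ?Q (m / 2) = 4 * (A m + cnj m)" unfolding \<rho> A_def by simp
      show "A m \<noteq> 0" using False by simp
      have "- (1/4) * (cnj (A m) * cnj m + m * A m) * ?Q (m / 2) + 1/4 * of_real \<rho> *
         (cnj (A m) / 2 * (pair_schwarzian h g (m / 2) + 1/2 * (?Q (m / 2))\<^sup>2) - A m / 2 * of_real (\<sigma> (m / 2))) - A m
         = A' m (cnj (A m))"
        unfolding A'_def L_def \<rho> by (simp add: algebra_simps)
      then show "Re ((- (1/4) * (cnj (A m) * cnj m + m * A m) * ?Q (m / 2) + 1/4 * of_real \<rho> *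
         (cnj (A m) / 2 * (pair_schwarzian h g (m / 2) + 1/2 * (?Q (m / 2))\<^sup>2) - A m / 2 * of_real (\<sigma> (m / 2))) - A m) * cnj (A m)) = 0"
        using crit by (simp only:)
    qed
    then show ?thesis unfolding N by simp
  qed
  moreover have "N z \<le> N m" by (rule m(2)) (use z in simp)
  ultimately have "N z \<le> 5/4" by linarith
  then show ?thesis unfolding N .
qed

lemma harmonic_pre_schwarzian_bound:
  assumes le: "pair_schwarzian_le 1 h g" and w: "cmod w \<le> 1/4"
  shows "cmod (harmonic_pre_schwarzian h g w) \<le> 10"
proof -
  let ?z = "2 * w" and ?q = "cmod (harmonic_pre_schwarzian h g w)"
  have z: "cmod ?z \<le> 1/2" using w by (simp add: norm_mult)
  define A where "A = 1/4 * (1 - ?z * cnj ?z) * harmonic_pre_schwarzian h g w - cnj ?z"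
  have "(cmod A)\<^sup>2 \<le> 5/4" using harmonic_order_bound[OF le, of ?z] z unfolding A_def by simp
  also have "\<dots> \<le> (5/4)\<^sup>2" by (simp add: power2_eq_square)
  finally have A: "cmod A \<le> 5/4" by (rule power2_le_imp_le) simp
  have "1/4 * (1 - ?z * cnj ?z) * harmonic_pre_schwarzian h g w = A + cnj ?z" unfolding A_def by simp
  then have "cmod (1/4 * (1 - ?z * cnj ?z) * harmonic_pre_schwarzian h g w) \<le> 5/4 + 1/2"
    using norm_triangle_ineq[of A "cnj ?z"] A z by (simp only: complex_mod_cnj)
  moreover have "1 - ?z * cnj ?z = of_real (1 - (cmod ?z)\<^sup>2)" by (simp only: complex_norm_square[symmetric] of_real_diff of_real_1)
  ultimately have 1: "1/4 * \<bar>1 - (cmod ?z)\<^sup>2\<bar> * ?q \<le> 7/4" by (simp only: norm_mult norm_of_real) simp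
  have "(cmod ?z)\<^sup>2 \<le> (1/2)\<^sup>2" using z by (intro power_mono) auto
  then have "3/4 \<le> \<bar>1 - (cmod ?z)\<^sup>2\<bar>" by (simp add: power2_eq_square)
  then have "1/4 * (3/4) * ?q \<le> 1/4 * \<bar>1 - (cmod ?z)\<^sup>2\<bar> * ?q" by (intro mult_right_mono mult_left_mono) auto
  then show ?thesis using 1 by simp
qed

section \<open>Coefficients and Taylor remainders\<close>

text \<open>
  A discrete Fourier analysis on the circle: the eight points \<open>r \<zeta>\<^sup>k\<close> with \<open>\<zeta>\<^sup>8 = 1\<close> suffice to separate
  \<open>(cnj z)\<^sup>2\<close> from all other monomials of degree at most two, and four of them to separate \<open>cnj z\<close>.
\<close>

lemma antiholomorphic_coefficients_bound:
  fixes s0 s1 s2 a b m :: complex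
  assumes r: "0 \<le> r"
    and T: "\<And>z. cmod z = r \<Longrightarrow>
      cmod (s0 + s1 * z + s2 * z\<^sup>2 + a * cnj z + m * (z * cnj z) + b * (cnj z)\<^sup>2) \<le> e"
  shows "cmod a * r \<le> e" and "cmod b * r\<^sup>2 \<le> e"
proof -
  define F where "F z = s0 + s1 * z + s2 * z\<^sup>2 + a * cnj z + m * (z * cnj z) + b * (cnj z)\<^sup>2" for z
  have F: "cmod (F z) \<le> e" if "cmod z = r" for z using T[OF that] unfolding F_def .
  have tri: "cmod (x1 + x2 - x3 - x4) \<le> 4 * e" if "cmod x1 \<le> e" "cmod x2 \<le> e" "cmod x3 \<le> e" "cmod x4 \<le> e" for x1 x2 x3 x4 :: complex
  proof -
    have "cmod (x1 + x2 - x3 - x4) \<le> cmod (x1 + x2 - x3) + cmod x4" by (rule norm_triangle_ineq4)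
    moreover have "cmod (x1 + x2 - x3) \<le> cmod (x1 + x2) + cmod x3" by (rule norm_triangle_ineq4)
    moreover have "cmod (x1 + x2) \<le> cmod x1 + cmod x2" by (rule norm_triangle_ineq)
    ultimately show ?thesis using that by linarith
  qed
  define R where "R = complex_of_real r"
  have R: "cnj R = R" "cmod R = r" using r unfolding R_def by auto
  have i2: "\<i> * \<i> = -1" by simp
  have "4 * (a * R) = F R + \<i> * F (\<i> * R) - F (- R) - \<i> * F (- \<i> * R)"
    unfolding F_def complex_cnj_mult complex_cnj_minus complex_cnj_i R using i2 by algebra
  then have "cmod (4 * (a * R)) \<le> 4 * e"
    by (simp only:) (rule tri; use R in \<open>auto intro!: F simp: norm_mult\<close>)
  then show "cmod a * r \<le> e" using R by (simp add: norm_mult)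
  \<comment> \<open>A primitive eighth root of unity turns \<open>s2\<close> into \<open>-s2\<close> relative to \<open>b\<close>.\<close>
  define u where "u = csqrt \<i>"
  have u: "u * u = \<i>" unfolding u_def by (metis power2_csqrt power2_eq_square)
  have "cmod u * cmod u = 1" using u by (metis norm_ii norm_mult)
  then have nu: "cmod u = 1" by (metis norm_ge_zero abs_of_nonneg real_sqrt_abs2 real_sqrt_one)
  have cu: "cnj u * cnj u = - \<i>" by (metis u complex_cnj_mult complex_cnj_i)
  have 1: "4 * (R\<^sup>2 * (s2 + b)) = F R + F (- R) - F (\<i> * R) - F (- \<i> * R)"
    unfolding F_def complex_cnj_mult complex_cnj_minus complex_cnj_i R using i2 by algebra
  have 2: "4 * (R\<^sup>2 * (- s2 + b)) = \<i> * F (u * R) + \<i> * F (- u * R) - \<i> * F (\<i> * u * R) - \<i> * F (- \<i> * u * R)"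
    unfolding F_def complex_cnj_mult complex_cnj_minus complex_cnj_i R using i2 u cu by algebra
  have "cmod (4 * (R\<^sup>2 * (s2 + b))) \<le> 4 * e"
    unfolding 1 by (rule tri; use R in \<open>auto intro!: F simp: norm_mult\<close>)
  moreover have "cmod (4 * (R\<^sup>2 * (- s2 + b))) \<le> 4 * e"
    unfolding 2 by (rule tri; use R nu in \<open>auto intro!: F simp: norm_mult\<close>)
  ultimately have "cmod (4 * (R\<^sup>2 * (s2 + b)) + 4 * (R\<^sup>2 * (- s2 + b))) \<le> 8 * e"
    using norm_triangle_ineq[of "4 * (R\<^sup>2 * (s2 + b))" "4 * (R\<^sup>2 * (- s2 + b))"] by linarith
  moreover have "4 * (R\<^sup>2 * (s2 + b)) + 4 * (R\<^sup>2 * (- s2 + b)) = 8 * (R\<^sup>2 * b)" by algebra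
  ultimately have "cmod (8 * (R\<^sup>2 * b)) \<le> 8 * e" by simp
  then show "cmod b * r\<^sup>2 \<le> e" using R by (simp add: norm_mult norm_power mult.commute)
qed

lemma Taylor_remainder_bound:
  assumes f: "f holomorphic_on unit_disk" and R: "0 < R" "R < 1"
    and M: "\<And>z. cmod z \<le> R \<Longrightarrow> cmod (f z) \<le> M"
  shows "cmod ((deriv ^^ k) f 0 / fact k) \<le> M / R ^ k"
    and "cmod z \<le> R / 2 \<Longrightarrow> cmod (f z - (\<Sum>k<n. (deriv ^^ k) f 0 / fact k * z ^ k)) \<le> 2 * M * (cmod z / R) ^ n"
proof -
  define c where "c k = (deriv ^^ k) f 0 / fact k" for k
  have M0: "0 \<le> M" using M[of 0] R norm_ge_zero[of "f 0"] by (simp del: norm_ge_zero)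
  have c: "cmod (c k) \<le> M / R ^ k" for k
  proof -
    have "cmod ((deriv ^^ k) f 0) \<le> fact k * M / R ^ k"
    proof (rule Cauchy_inequality)
      show "f holomorphic_on ball 0 R" using f by (rule holomorphic_on_subset) (use R in auto)
      show "continuous_on (cball 0 R) f"
        by (rule continuous_on_subset[OF holomorphic_on_imp_continuous_on[OF f]]) (use R in auto)
    qed (use R M in auto)
    then show ?thesis unfolding c_def by (simp add: norm_divide field_simps)
  qed
  then show "cmod ((deriv ^^ k) f 0 / fact k) \<le> M / R ^ k" unfolding c_def .
  show "cmod (f z - (\<Sum>k<n. (deriv ^^ k) f 0 / fact k * z ^ k)) \<le> 2 * M * (cmod z / R) ^ n" if z: "cmod z \<le> R / 2"
  proof -
    have zD: "z \<in> ball 0 1" using z R by auto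
    have "(\<lambda>k. c k * z ^ k) sums f z" using holomorphic_power_series[OF f zD] unfolding c_def by simp
    then have s: "(\<lambda>k. c (k + n) * z ^ (k + n)) sums (f z - (\<Sum>k<n. c k * z ^ k))" by (rule sums_split_initial_segment)
    define q where "q = cmod z / R"
    have q: "0 \<le> q" "q \<le> 1/2" using z R unfolding q_def by (auto simp: field_simps)
    have b: "cmod (c (k + n) * z ^ (k + n)) \<le> M * q ^ n * (1/2) ^ k" for k
    proof -
      have "cmod (c (k + n) * z ^ (k + n)) \<le> M / R ^ (k + n) * cmod z ^ (k + n)"
        unfolding norm_mult norm_power by (intro mult_right_mono c) auto
      also have "\<dots> = M * q ^ n * q ^ k" unfolding q_def by (simp add: power_divide power_add mult_ac)
      also have "\<dots> \<le> M * q ^ n * (1/2) ^ k" using q M0 by (intro mult_left_mono power_mono) auto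
      finally show ?thesis .
    qed
    have g: "(\<lambda>k. M * q ^ n * (1/2) ^ k) sums (M * q ^ n * 2)"
      using sums_mult[OF geometric_sums[of "1/2::real"], of "M * q ^ n"] by simp
    have "cmod (f z - (\<Sum>k<n. c k * z ^ k)) = cmod (\<Sum>k. c (k + n) * z ^ (k + n))" using sums_unique[OF s] by simp
    also have "\<dots> \<le> (\<Sum>k. M * q ^ n * (1/2) ^ k)" by (rule norm_suminf_le[OF b sums_summable[OF g]])
    also have "\<dots> = 2 * M * (cmod z / R) ^ n" using sums_unique[OF g] unfolding q_def by simp
    finally show ?thesis unfolding c_def .
  qed
qed

text \<open>
  The constant is \<open>153600 = 2 \<cdot> 150 \<cdot> 8\<^sup>3\<close>: the remainder bound of order three for the bound 150 on the
  disk of radius \<open>1/8\<close>. It dominates the other constants, so that one constant serves in all estimates.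
\<close>

lemma quadratic_Taylor_bounds:
  assumes f: "f holomorphic_on unit_disk" and M: "\<And>z. cmod z \<le> 1/8 \<Longrightarrow> cmod (f z) \<le> 150"
    and z: "cmod z \<le> 1/16"
  defines "E \<equiv> 153600 :: real"
  shows "cmod (deriv f 0) \<le> E" "cmod (deriv (deriv f) 0 / 2) \<le> E" "cmod (f z) \<le> E"
    and "cmod (f z - f 0) \<le> E * cmod z"
    and "cmod (f z - (f 0 + deriv f 0 * z)) \<le> E * cmod z ^ 2"
    and "cmod (f z - (f 0 + deriv f 0 * z + deriv (deriv f) 0 / 2 * z\<^sup>2)) \<le> E * cmod z ^ 3"
proof -
  have R: "(0::real) < 1/8" "(1/8::real) < 1" by auto
  note T = Taylor_remainder_bound[OF f R M]
  have z': "cmod z \<le> 1/8/2" using z by simp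
  show "cmod (f z) \<le> E" using M[of z] z unfolding E_def by auto
  show "cmod (deriv f 0) \<le> E" using T(1)[of 1] unfolding E_def by simp
  show "cmod (deriv (deriv f) 0 / 2) \<le> E" using T(1)[of 2] unfolding E_def by (simp add: eval_nat_numeral)
  have "cmod (f z - f 0) \<le> 2 * 150 * (cmod z / (1/8)) ^ 1" using T(2)[OF _ z', of 1] by simp
  also have "\<dots> \<le> E * cmod z" unfolding E_def by simp
  finally show "cmod (f z - f 0) \<le> E * cmod z" .
  have "cmod (f z - (f 0 + deriv f 0 * z)) \<le> 2 * 150 * (cmod z / (1/8)) ^ 2"
    using T(2)[OF _ z', of 2] by (simp add: eval_nat_numeral)
  also have "\<dots> \<le> E * cmod z ^ 2" unfolding E_def by (simp add: power_mult_distrib)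
  finally show "cmod (f z - (f 0 + deriv f 0 * z)) \<le> E * cmod z ^ 2" .
  have "cmod (f z - (f 0 + deriv f 0 * z + deriv (deriv f) 0 / 2 * z\<^sup>2)) \<le> 2 * 150 * (cmod z / (1/8)) ^ 3"
    using T(2)[OF _ z', of 3] by (simp add: eval_nat_numeral mult.assoc)
  also have "\<dots> \<le> E * cmod z ^ 3" unfolding E_def by (simp add: power_mult_distrib)
  finally show "cmod (f z - (f 0 + deriv f 0 * z + deriv (deriv f) 0 / 2 * z\<^sup>2)) \<le> E * cmod z ^ 3" .
qed

lemma Cauchy_deriv_bound_half_radius:
  assumes f: "f holomorphic_on unit_disk" and R: "0 < R" "2 * R < 1"
    and M: "\<And>z. cmod z \<le> 2 * R \<Longrightarrow> cmod (f z) \<le> M" and z: "cmod z \<le> R"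
  shows "cmod (deriv f z) \<le> M / R"
proof -
  have sub: "cball z R \<subseteq> cball 0 (2 * R)" 
  proof
    fix w assume "w \<in> cball z R"
    then have "cmod (w - z) \<le> R" by (simp add: dist_norm norm_minus_commute)
    then show "w \<in> cball 0 (2 * R)" using norm_triangle_sub[of w z] z by simp
  qed
  have sub1: "cball z R \<subseteq> unit_disk" by (rule order_trans[OF sub]) (use R in auto)
  have "cmod ((deriv ^^ 1) f z) \<le> fact 1 * M / R ^ 1"
  proof (rule Cauchy_inequality)
    show "continuous_on (cball z R) f"
      by (rule continuous_on_subset[OF holomorphic_on_imp_continuous_on[OF f] sub1])
    show "f holomorphic_on ball z R" using f by (rule holomorphic_on_subset) (use sub1 ball_subset_cball in blast)
    show "cmod (f w) \<le> M" if "cmod (z - w) = R" for w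
      using sub that by (intro M) (auto simp: dist_norm subset_iff)
  qed (use R in auto)
  then show ?thesis by simp
qed

text \<open>
  A priori bounds near the origin for everything in the formula of \<open>S\<^sub>f\<close>, uniform over all pairs
  with Schwarzian norm at most one and \<open>\<omega>(0) = 0\<close>. The bound on the harmonic pre-Schwarzian controls \<open>h''/h'\<close>, the Schwarz--Pick lemma controls \<open>\<omega>'\<close>,
  and Cauchy estimates on halved disks give the remaining derivatives. The constant 150 is only a
  convenient common bound.
\<close>

lemma local_bounds:
  assumes le: "pair_schwarzian_le 1 h g" and w0: "dil h g 0 = 0"
  defines "\<omega> \<equiv> dil h g" and "P \<equiv> pre_schwarzian h"
  shows "cmod z < 1 \<Longrightarrow> cmod (\<omega> z) \<le> cmod z"
    and "cmod z \<le> 1/8 \<Longrightarrow> cmod (\<omega> z) \<le> 150"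
    and "cmod z \<le> 1/8 \<Longrightarrow> cmod ((deriv \<omega> z)\<^sup>2) \<le> 150"
    and "cmod z \<le> 1/8 \<Longrightarrow> cmod (P z * deriv \<omega> z - deriv (deriv \<omega>) z) \<le> 150"
    and "cmod z \<le> 1/8 \<Longrightarrow> cmod (schwarzian h z) \<le> 150"
proof -
  have sp: "sense_preserving_pair h g" using le unfolding pair_schwarzian_le_def by blast
  note hol = sense_preserving_pairD[OF sp]
  have \<omega>: "\<omega> holomorphic_on unit_disk" using hol(5) \<omega>_def by simp
  have Ph: "P holomorphic_on unit_disk" unfolding P_def by (rule pre_schwarzian_holomorphic[OF hol(1) open_ball hol(3)])
  show s: "cmod (\<omega> z) \<le> cmod z" if "cmod z < 1" for z
    by (rule Schwarz_Lemma(1)[OF \<omega>]) (use w0 hol(4) that in \<open>auto simp: \<omega>_def\<close>)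
  then show "cmod (\<omega> z) \<le> 150" if "cmod z \<le> 1/8" for z
    using s[of z] that by linarith
  have w1: "cmod (deriv \<omega> z) \<le> 16/15" if z: "cmod z \<le> 1/4" for z
  proof -
    have "(cmod z)\<^sup>2 \<le> (1/4)\<^sup>2" using z by (intro power_mono) auto
    then have "15/16 \<le> 1 - (cmod z)\<^sup>2" by (simp add: power2_eq_square)
    then have "cmod (deriv \<omega> z) * (15/16) \<le> cmod (deriv \<omega> z) * (1 - (cmod z)\<^sup>2)" by (intro mult_left_mono) auto
    also have "\<dots> \<le> 1 - (cmod (\<omega> z))\<^sup>2" unfolding \<omega>_def using z by (intro Schwarz_Pick_dilatation[OF sp]) auto
    also have "\<dots> \<le> 1" by simp
    finally show ?thesis by simp
  qed
  have P: "cmod (P z) \<le> 11" if z: "cmod z \<le> 1/4" for z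
  proof -
    have wz: "cmod (\<omega> z) \<le> 1/4" using s[of z] z by simp
    then have "(cmod (\<omega> z))\<^sup>2 \<le> (1/4)\<^sup>2" by (intro power_mono) auto
    then have d: "1 - (cmod (\<omega> z))\<^sup>2 \<ge> 1/2" by (simp add: power2_eq_square)
    have "P z = harmonic_pre_schwarzian h g z + cnj (\<omega> z) * deriv \<omega> z / (1 - cnj (\<omega> z) * \<omega> z)"
      unfolding harmonic_pre_schwarzian_def P_def \<omega>_def by simp
    then have "cmod (P z) \<le> cmod (harmonic_pre_schwarzian h g z) + cmod (cnj (\<omega> z) * deriv \<omega> z / (1 - cnj (\<omega> z) * \<omega> z))"
      using norm_triangle_ineq by metis
    moreover have "cmod (cnj (\<omega> z) * deriv \<omega> z / (1 - cnj (\<omega> z) * \<omega> z)) \<le> 1"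
    proof -
      have "cmod (cnj (\<omega> z) * deriv \<omega> z / (1 - cnj (\<omega> z) * \<omega> z)) = cmod (\<omega> z) * cmod (deriv \<omega> z) / (1 - (cmod (\<omega> z))\<^sup>2)"
        unfolding one_minus_cnj_mult norm_divide norm_mult norm_of_real using d by simp
      also have "\<dots> \<le> (1/4) * (16/15) / (1/2)" using wz w1[OF z] d by (intro frac_le mult_mono) auto
      finally show ?thesis by simp
    qed
    ultimately show ?thesis using harmonic_pre_schwarzian_bound[OF le z] by linarith
  qed
  show "cmod ((deriv \<omega> z)\<^sup>2) \<le> 150" if "cmod z \<le> 1/8" for z
  proof -
    have "(cmod (deriv \<omega> z))\<^sup>2 \<le> (16/15)\<^sup>2" using w1[of z] that by (intro power_mono) auto
    then show ?thesis by (simp add: norm_mult power2_eq_square)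
  qed
  show "cmod (P z * deriv \<omega> z - deriv (deriv \<omega>) z) \<le> 150" if z: "cmod z \<le> 1/8" for z
  proof -
    have "cmod (deriv (deriv \<omega>) z) \<le> 16/15 / (1/8)"
      by (rule Cauchy_deriv_bound_half_radius[OF holomorphic_deriv[OF \<omega> open_ball] _ _ w1 z]) auto
    moreover have "cmod (P z * deriv \<omega> z) \<le> 11 * (16/15)"
      unfolding norm_mult using P[of z] w1[of z] z by (intro mult_mono) auto
    ultimately show ?thesis using norm_triangle_ineq4[of "P z * deriv \<omega> z" "deriv (deriv \<omega>) z"] by simp
  qed
  show "cmod (schwarzian h z) \<le> 150" if z: "cmod z \<le> 1/8" for z
  proof -
    have "cmod (deriv P z) \<le> 11 / (1/8)" by (rule Cauchy_deriv_bound_half_radius[OF Ph _ _ P z]) auto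
    moreover have "cmod (1/2 * (P z)\<^sup>2) \<le> 1/2 * 11\<^sup>2"
      unfolding norm_mult norm_power using P[of z] z by (intro mult_mono power_mono) auto
    ultimately show ?thesis using norm_triangle_ineq4[of "deriv P z" "1/2 * (P z)\<^sup>2"]
      unfolding schwarzian_def P_def[symmetric] by simp
  qed
qed

section \<open>Smallness of the dilatation\<close>

text \<open>
  The expansion of \<open>S\<^sub>f\<close> to second order in \<open>z\<close> and \<open>cnj z\<close>. Here \<open>w\<close>, \<open>B\<close>, \<open>W\<close>, \<open>S\<close> stand for the values at
  \<open>z\<close> of \<open>\<omega>\<close>, \<open>(h''/h') \<omega>' - \<omega>''\<close>, \<open>\<omega>'\<^sup>2\<close>, \<open>S(h)\<close>, and the indexed letters for their Taylor
  coefficients at the origin. Since \<open>|\<omega>(z)| \<le> |z|\<close>, the denominators \<open>1 - |\<omega>|\<^sup>2\<close> differ from \<open>1\<close> by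
  \<open>O(|z|\<^sup>2)\<close> and influence only the error. The factor 23 rounds up \<open>1 + 2 + 3 + (3/2) \<cdot> 9\<close>.
\<close>

lemma second_order_expansion:
  fixes w B W S w1 w2 B0 B1 W0 s0 s1 s2 z :: complex and E :: real
  assumes E: "E \<ge> 1" and z: "cmod z \<le> 1/16"
    and w: "cmod w \<le> cmod z" "cmod (w - (w1 * z + w2 * z\<^sup>2)) \<le> E * cmod z ^ 3" "cmod (w - w1 * z) \<le> E * cmod z ^ 2"
    and w12: "cmod w1 \<le> E" "cmod w2 \<le> E"
    and B: "cmod B \<le> E" "cmod (B - B0) \<le> E * cmod z" "cmod (B - (B0 + B1 * z)) \<le> E * cmod z ^ 2"
    and W: "cmod W \<le> E" "cmod (W - W0) \<le> E * cmod z"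
    and S: "cmod (S - (s0 + s1 * z + s2 * z\<^sup>2)) \<le> E * cmod z ^ 3"
  shows "cmod ((S + cnj w / (1 - cnj w * w) * B - 3/2 * ((cnj w)\<^sup>2 * W / (1 - cnj w * w)\<^sup>2))
     - (s0 + s1 * z + s2 * z\<^sup>2 + (cnj w1 * B0) * cnj z + (cnj w1 * B1) * (z * cnj z)
         + (cnj w2 * B0 - 3/2 * ((cnj w1)\<^sup>2 * W0)) * (cnj z)\<^sup>2)) \<le> 23 * E ^ 3 * cmod z ^ 3"
proof -
  define r where "r = cmod z"
  have r: "0 \<le> r" "r \<le> 1/16" "r \<le> 1" using z unfolding r_def by auto
  define k where "k = 1 / (1 - cnj w * w)"
  have w2: "(cmod w)\<^sup>2 \<le> r\<^sup>2" using w(1) unfolding r_def by (intro power_mono) auto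
  have r2: "r\<^sup>2 \<le> r * (1/16)" using r unfolding power2_eq_square by (intro mult_left_mono) auto
  have d: "1 - (cmod w)\<^sup>2 \<ge> 1/2" using w2 r2 r by linarith
  have nz: "1 - cnj w * w \<noteq> 0" unfolding one_minus_cnj_mult using d by (simp del: of_real_diff of_real_power)
  have k: "cmod k \<le> 2" unfolding k_def one_minus_cnj_mult norm_divide norm_of_real using d by (simp add: field_simps)
  have k1: "k - 1 = cnj w * w * k" unfolding k_def using nz by (simp add: field_simps)
  have ww: "cmod (cnj w * w) \<le> r\<^sup>2" using w2 by (simp add: norm_mult power2_eq_square)
  have k1b: "cmod (k - 1) \<le> r\<^sup>2 * 2" unfolding k1 norm_mult[of _ k] using ww k by (intro mult_mono) auto
  have p3: "r ^ 3 = r\<^sup>2 * r" by (simp add: eval_nat_numeral)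
  have E1: "0 \<le> E" using E by simp
  have EE: "E \<le> E ^ 3" "E\<^sup>2 \<le> E ^ 3" using E by (auto intro: power_increasing[of _ 3 E, simplified] power_increasing[of 1 3 E, simplified])
  have t2: "cmod (cnj w * B * (k - 1)) \<le> 2 * E * r ^ 3"
  proof -
    have "cmod (cnj w * B * (k - 1)) \<le> (r * E) * (r\<^sup>2 * 2)"
      unfolding norm_mult using w(1) B(1) k1b E1 r unfolding r_def[symmetric] by (intro mult_mono) auto
    then show ?thesis by (simp add: p3 mult_ac)
  qed
  have t3: "cmod (cnj (w - (w1 * z + w2 * z\<^sup>2)) * B + cnj w1 * cnj z * (B - (B0 + B1 * z)) + cnj w2 * (cnj z)\<^sup>2 * (B - B0))
     \<le> 3 * E\<^sup>2 * r ^ 3"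
  proof -
    have "cmod (cnj (w - (w1 * z + w2 * z\<^sup>2)) * B) \<le> (E * r ^ 3) * E"
      unfolding norm_mult complex_mod_cnj r_def by (intro mult_mono w B) (use E1 in auto)
    moreover have "cmod (cnj w1 * cnj z * (B - (B0 + B1 * z))) \<le> (E * r) * (E * r ^ 2)"
      unfolding norm_mult complex_mod_cnj r_def by (intro mult_mono w12 B order_refl) (use E1 in auto)
    moreover have "cmod (cnj w2 * (cnj z)\<^sup>2 * (B - B0)) \<le> (E * r\<^sup>2) * (E * r)"
      unfolding norm_mult norm_power complex_mod_cnj r_def by (intro mult_mono w12 B order_refl) (use E1 in auto)
    ultimately show ?thesis
      using norm_triangle_ineq[of "cnj (w - (w1 * z + w2 * z\<^sup>2)) * B + cnj w1 * cnj z * (B - (B0 + B1 * z))" "cnj w2 * (cnj z)\<^sup>2 * (B - B0)"]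
        norm_triangle_ineq[of "cnj (w - (w1 * z + w2 * z\<^sup>2)) * B" "cnj w1 * cnj z * (B - (B0 + B1 * z))"]
      by (simp add: p3 power2_eq_square mult_ac)
  qed
  have t4: "cmod ((cnj w)\<^sup>2 * W * ((k - 1) * (k + 1)) + cnj (w - w1 * z) * cnj (w + w1 * z) * W + (cnj w1)\<^sup>2 * (cnj z)\<^sup>2 * (W - W0))
     \<le> 9 * E ^ 3 * r ^ 3"
  proof -
    have "cmod (k + 1) \<le> 3" using norm_triangle_ineq[of k 1] k by simp
    then have "cmod ((cnj w)\<^sup>2 * W * ((k - 1) * (k + 1))) \<le> (r\<^sup>2 * E) * (r\<^sup>2 * 2 * 3)"
      unfolding norm_mult norm_power complex_mod_cnj using w2 k1b W(1) E1 by (intro mult_mono) auto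
    also have "\<dots> = (6 * E * r\<^sup>2) * r\<^sup>2" by (simp add: mult_ac)
    also have "\<dots> \<le> (6 * E * r\<^sup>2) * r" using r r2 E1 by (intro mult_left_mono) auto
    also have "\<dots> = 6 * E * r ^ 3" by (simp add: p3)
    also have "\<dots> \<le> 6 * E ^ 3 * r ^ 3" using EE r by (intro mult_right_mono mult_left_mono) auto
    finally have 1: "cmod ((cnj w)\<^sup>2 * W * ((k - 1) * (k + 1))) \<le> 6 * E ^ 3 * r ^ 3" .
    have "cmod (w + w1 * z) \<le> r + E * r" using norm_triangle_ineq[of w "w1 * z"] w(1) mult_right_mono[OF w12(1), of r] r
      unfolding norm_mult r_def by linarith
    also have "\<dots> \<le> 2 * (E * r)" using mult_right_mono[OF E r(1)] by simp
    finally have "cmod (cnj (w - w1 * z) * cnj (w + w1 * z) * W) \<le> (E * r\<^sup>2) * (2 * (E * r)) * E"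
      unfolding norm_mult complex_mod_cnj using w(3) W(1) E1 r unfolding r_def[symmetric] by (intro mult_mono) auto
    then have 2: "cmod (cnj (w - w1 * z) * cnj (w + w1 * z) * W) \<le> 2 * E ^ 3 * r ^ 3"
      by (simp add: eval_nat_numeral mult_ac)
    have "cmod ((cnj w1)\<^sup>2 * (cnj z)\<^sup>2 * (W - W0)) \<le> (E\<^sup>2 * r\<^sup>2) * (E * r)"
      unfolding norm_mult norm_power complex_mod_cnj r_def by (intro mult_mono power_mono w12 W order_refl) (use E1 in auto)
    then have 3: "cmod ((cnj w1)\<^sup>2 * (cnj z)\<^sup>2 * (W - W0)) \<le> E ^ 3 * r ^ 3"
      by (simp add: eval_nat_numeral mult_ac)
    show ?thesis using 1 2 3
      norm_triangle_ineq[of "(cnj w)\<^sup>2 * W * ((k - 1) * (k + 1)) + cnj (w - w1 * z) * cnj (w + w1 * z) * W" "(cnj w1)\<^sup>2 * (cnj z)\<^sup>2 * (W - W0)"]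
      norm_triangle_ineq[of "(cnj w)\<^sup>2 * W * ((k - 1) * (k + 1))" "cnj (w - w1 * z) * cnj (w + w1 * z) * W"] by linarith
  qed
  \<comment> \<open>The four error terms: from \<open>S\<close>, from the denominator of the linear term, from the truncation of the linear term, and both errors of the quadratic term.\<close>
  define X1 where "X1 = S - (s0 + s1 * z + s2 * z\<^sup>2)"
  define X2 where "X2 = cnj w * B * (k - 1)"
  define X3 where "X3 = cnj (w - (w1 * z + w2 * z\<^sup>2)) * B + cnj w1 * cnj z * (B - (B0 + B1 * z)) + cnj w2 * (cnj z)\<^sup>2 * (B - B0)"
  define X4 where "X4 = (cnj w)\<^sup>2 * W * ((k - 1) * (k + 1)) + cnj (w - w1 * z) * cnj (w + w1 * z) * W + (cnj w1)\<^sup>2 * (cnj z)\<^sup>2 * (W - W0)"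
  have "(S + cnj w / (1 - cnj w * w) * B - 3/2 * ((cnj w)\<^sup>2 * W / (1 - cnj w * w)\<^sup>2))
     - (s0 + s1 * z + s2 * z\<^sup>2 + (cnj w1 * B0) * cnj z + (cnj w1 * B1) * (z * cnj z)
         + (cnj w2 * B0 - 3/2 * ((cnj w1)\<^sup>2 * W0)) * (cnj z)\<^sup>2)
    = (S + cnj w * k * B - 3/2 * ((cnj w)\<^sup>2 * W * k\<^sup>2))
     - (s0 + s1 * z + s2 * z\<^sup>2 + (cnj w1 * B0) * cnj z + (cnj w1 * B1) * (z * cnj z)
         + (cnj w2 * B0 - 3/2 * ((cnj w1)\<^sup>2 * W0)) * (cnj z)\<^sup>2)"
    unfolding k_def by (simp add: power_divide)
  also have "\<dots> = X1 + X2 + X3 - 3/2 * X4"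
    unfolding X1_def X2_def X3_def X4_def complex_cnj_diff complex_cnj_add complex_cnj_mult complex_cnj_power by algebra
  finally have eq: "(S + cnj w / (1 - cnj w * w) * B - 3/2 * ((cnj w)\<^sup>2 * W / (1 - cnj w * w)\<^sup>2))
     - (s0 + s1 * z + s2 * z\<^sup>2 + (cnj w1 * B0) * cnj z + (cnj w1 * B1) * (z * cnj z)
         + (cnj w2 * B0 - 3/2 * ((cnj w1)\<^sup>2 * W0)) * (cnj z)\<^sup>2) = X1 + X2 + X3 - 3/2 * X4" .
  have "cmod (X1 + X2 + X3 - 3/2 * X4) \<le> cmod X1 + cmod X2 + cmod X3 + cmod (3/2 * X4)"
    by (meson add_mono norm_triangle_ineq norm_triangle_ineq4 order_refl order_trans)
  also have "cmod (3/2 * X4) = 3/2 * cmod X4" by (simp add: norm_mult)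
  also have "cmod X1 + cmod X2 + cmod X3 + 3/2 * cmod X4 \<le> E * r ^ 3 + 2 * E * r ^ 3 + 3 * E\<^sup>2 * r ^ 3 + 3/2 * (9 * E ^ 3 * r ^ 3)"
    using S t2 t3 t4 unfolding X1_def X2_def X3_def X4_def r_def by linarith
  also have "\<dots> \<le> E ^ 3 * r ^ 3 + 2 * E ^ 3 * r ^ 3 + 3 * E ^ 3 * r ^ 3 + 3/2 * (9 * E ^ 3 * r ^ 3)"
    using EE r by (intro add_mono mult_right_mono mult_left_mono order_refl) auto
  also have "\<dots> \<le> 23 * E ^ 3 * r ^ 3" using E1 r by (simp add: zero_le_mult_iff)
  finally show ?thesis unfolding eq r_def .
qed

text \<open>
  The only nonholomorphic terms of order at most two in \<open>S\<^sub>f\<close> are multiples of \<open>cnj z\<close>, \<open>|z|\<^sup>2\<close> and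
  \<open>(cnj z)\<^sup>2\<close>. If \<open>|S\<^sub>f|\<close> is of size \<open>r\<^sup>3\<close> on the circle \<open>|z| = r\<close>, which is also the size of the Taylor
  error, then the coefficient \<open>cnj \<omega>\<^sub>1 \<cdot> B\<^sub>0\<close> of \<open>cnj z\<close> is \<open>O(r\<^sup>2)\<close> and the coefficient
  \<open>cnj \<omega>\<^sub>2 \<cdot> B\<^sub>0 - (3/2) |\<omega>\<^sub>1|\<^sup>4\<close> of \<open>(cnj z)\<^sup>2\<close> is \<open>O(r)\<close>, where \<open>B\<^sub>0\<close> is the value of
  \<open>(h''/h') \<omega>' - \<omega>''\<close> at the origin. Here \<open>\<omega>\<^sub>1 = \<omega>'(0)\<close> and \<open>\<omega>\<^sub>2 = \<omega>''(0)/2\<close>. Multiplying the second estimate by \<open>|\<omega>\<^sub>1|\<close> and using the first to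
  remove \<open>B\<^sub>0\<close> leaves \<open>|\<omega>\<^sub>1|\<^sup>5 = O(r)\<close>.
\<close>

lemma dilatation_derivative_small:
  fixes r :: real
  defines "K \<equiv> (2 + 23 * 153600 ^ 3) * (1 + 153600) :: real"
  assumes r: "0 < r" "r \<le> 1/16" and le: "pair_schwarzian_le (r ^ 3) h g" and w0: "dil h g 0 = 0"
  shows "cmod (deriv (dil h g) 0) ^ 5 \<le> K * r"
proof -
  define E where "E = (153600 :: real)"
  define C where "C = 2 + 23 * E ^ 3"
  have K: "K = C * (1 + E)" unfolding K_def C_def E_def by simp
  have E: "E \<ge> 1" "E \<ge> 0" unfolding E_def by auto
  have C0: "C \<ge> 0" unfolding C_def using E by simp
  have sp: "sense_preserving_pair h g" using le unfolding pair_schwarzian_le_def by blast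
  have r31: "r ^ 3 \<le> 1" using r by (intro power_le_one) auto
  have le1: "pair_schwarzian_le 1 h g" using le r31 unfolding pair_schwarzian_le_def by (meson order_trans)
  note hol = sense_preserving_pairD[OF sp]
  note lb = local_bounds[OF le1 w0]
  define \<omega> where "\<omega> = dil h g"
  define B where "B z = pre_schwarzian h z * deriv \<omega> z - deriv (deriv \<omega>) z" for z
  define W where "W z = (deriv \<omega> z)\<^sup>2" for z
  have \<omega>: "\<omega> holomorphic_on unit_disk" using hol(5) \<omega>_def by simp
  have Bh: "B holomorphic_on unit_disk" unfolding B_def
    by (intro holomorphic_intros pre_schwarzian_holomorphic[OF hol(1) open_ball hol(3)] \<omega> open_ball)
  have Wh: "W holomorphic_on unit_disk" unfolding W_def by (intro holomorphic_intros \<omega> open_ball)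
  have Sh: "schwarzian h holomorphic_on unit_disk" by (rule schwarzian_holomorphic[OF hol(1) open_ball hol(3)])
  note Tw = quadratic_Taylor_bounds[OF \<omega> lb(2)[folded \<omega>_def], folded E_def]
  note TB = quadratic_Taylor_bounds[OF Bh lb(4)[folded \<omega>_def, folded B_def], folded E_def]
  note TW = quadratic_Taylor_bounds[OF Wh lb(3)[folded \<omega>_def, folded W_def], folded E_def]
  note TS = quadratic_Taylor_bounds[OF Sh lb(5), folded E_def]
  define w1 where "w1 = deriv \<omega> 0"
  define w2 where "w2 = deriv (deriv \<omega>) 0 / 2"
  have w00: "\<omega> 0 = 0" using w0 \<omega>_def by simp
  have z16: "cmod (0::complex) \<le> 1/16" by simp
  have "cmod (schwarzian h 0 + deriv (schwarzian h) 0 * z + deriv (deriv (schwarzian h)) 0 / 2 * z\<^sup>2 + (cnj w1 * B 0) * cnj z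
      + (cnj w1 * deriv B 0) * (z * cnj z) + (cnj w2 * B 0 - 3/2 * ((cnj w1)\<^sup>2 * W 0)) * (cnj z)\<^sup>2) \<le> C * r ^ 3"
    (is "cmod ?T \<le> _") if z: "cmod z = r" for z
  proof -
    have z1: "cmod z \<le> 1/16" using z r by simp
    have zD: "z \<in> unit_disk" using z r by simp
    have "cmod ((schwarzian h z + cnj (\<omega> z) / (1 - cnj (\<omega> z) * \<omega> z) * B z - 3/2 * ((cnj (\<omega> z))\<^sup>2 * W z / (1 - cnj (\<omega> z) * \<omega> z)\<^sup>2)) - ?T)
       \<le> 23 * E ^ 3 * cmod z ^ 3"
    proof (rule second_order_expansion[OF E(1) z1])
      show "cmod (\<omega> z) \<le> cmod z" using lb(1)[of z] zD unfolding \<omega>_def by simp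
      show "cmod (\<omega> z - (w1 * z + w2 * z\<^sup>2)) \<le> E * cmod z ^ 3" "cmod (\<omega> z - w1 * z) \<le> E * cmod z ^ 2"
        using Tw(5,6)[OF _ z1] unfolding w00 w1_def w2_def by simp_all
      show "cmod w1 \<le> E" "cmod w2 \<le> E" using Tw(1,2)[OF _ z1] unfolding w1_def w2_def by auto
      show "cmod (B z) \<le> E" "cmod (B z - B 0) \<le> E * cmod z" "cmod (B z - (B 0 + deriv B 0 * z)) \<le> E * cmod z ^ 2"
        using TB(3,4,5)[OF _ z1] by auto
      show "cmod (W z) \<le> E" "cmod (W z - W 0) \<le> E * cmod z" using TW(3,4)[OF _ z1] by auto
      show "cmod (schwarzian h z - (schwarzian h 0 + deriv (schwarzian h) 0 * z + deriv (deriv (schwarzian h)) 0 / 2 * z\<^sup>2)) \<le> E * cmod z ^ 3"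
        using TS(6)[OF _ z1] by auto
    qed
    moreover have "pair_schwarzian h g z = schwarzian h z + cnj (\<omega> z) / (1 - cnj (\<omega> z) * \<omega> z) * B z - 3/2 * ((cnj (\<omega> z))\<^sup>2 * W z / (1 - cnj (\<omega> z) * \<omega> z)\<^sup>2)"
      using pair_schwarzian_formula[OF sp zD] unfolding \<omega>_def B_def W_def by (simp add: power_divide power_mult_distrib)
    ultimately have 1: "cmod (pair_schwarzian h g z - ?T) \<le> 23 * E ^ 3 * r ^ 3" unfolding z by simp
    have "r\<^sup>2 \<le> (1/16)\<^sup>2" using r by (intro power_mono) auto
    then have "(255/256)\<^sup>2 \<le> (1 - r\<^sup>2)\<^sup>2" by (intro power_mono) (auto simp: power2_eq_square)
    then have "1/2 \<le> (1 - r\<^sup>2)\<^sup>2" by (simp add: power2_eq_square)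
    then have "cmod (pair_schwarzian h g z) * (1/2) \<le> cmod (pair_schwarzian h g z) * (1 - r\<^sup>2)\<^sup>2" by (intro mult_left_mono) auto
    also have "\<dots> \<le> r ^ 3" using le zD z unfolding pair_schwarzian_le_def by blast
    finally have 2: "cmod (pair_schwarzian h g z) \<le> 2 * r ^ 3" by simp
    have "cmod ?T \<le> cmod (pair_schwarzian h g z) + cmod (pair_schwarzian h g z - ?T)"
      by (metis norm_minus_commute norm_triangle_sub)
    also have "\<dots> \<le> C * r ^ 3" unfolding C_def using 1 2 by (simp add: distrib_right)
    finally show ?thesis .
  qed
  from antiholomorphic_coefficients_bound[OF less_imp_le[OF r(1)] this]
  have "cmod (cnj w1 * B 0) * r \<le> C * r\<^sup>2 * r" "cmod (cnj w2 * B 0 - 3/2 * ((cnj w1)\<^sup>2 * W 0)) * r\<^sup>2 \<le> C * r * r\<^sup>2"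
    by (simp_all add: power3_eq_cube power2_eq_square mult_ac)
  then have a: "cmod w1 * cmod (B 0) \<le> C * r\<^sup>2" and b: "cmod (cnj w2 * B 0 - 3/2 * ((cnj w1)\<^sup>2 * W 0)) \<le> C * r"
    using r by (simp_all add: norm_mult)
  have "3/2 * ((cnj w1)\<^sup>2 * W 0) = cnj w2 * B 0 - (cnj w2 * B 0 - 3/2 * ((cnj w1)\<^sup>2 * W 0))" by simp
  then have "cmod (3/2 * ((cnj w1)\<^sup>2 * W 0)) \<le> cmod (cnj w2 * B 0) + cmod (cnj w2 * B 0 - 3/2 * ((cnj w1)\<^sup>2 * W 0))"
    using norm_triangle_ineq4 by metis
  moreover have "cmod (3/2 * ((cnj w1)\<^sup>2 * W 0)) = 3/2 * cmod w1 ^ 4"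
    unfolding W_def w1_def[symmetric] by (simp add: norm_mult norm_power eval_nat_numeral)
  moreover have "cmod (cnj w2 * B 0) = cmod w2 * cmod (B 0)" by (simp add: norm_mult)
  ultimately have 4: "3/2 * cmod w1 ^ 4 \<le> cmod w2 * cmod (B 0) + C * r" using b by linarith
  have w1: "cmod w1 \<le> 1" unfolding w1_def
    by (rule Schwarz_Lemma(2)[OF \<omega> w00, of 0]) (use hol(4) in \<open>auto simp: \<omega>_def\<close>)
  have w2: "cmod w2 \<le> E" using Tw(2)[OF _ z16] unfolding w2_def by auto
  have "3/2 * cmod w1 ^ 5 = cmod w1 * (3/2 * cmod w1 ^ 4)" by (simp add: eval_nat_numeral)
  also have "\<dots> \<le> cmod w1 * (cmod w2 * cmod (B 0) + C * r)" using 4 by (intro mult_left_mono) auto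
  also have "\<dots> = cmod w2 * (cmod w1 * cmod (B 0)) + cmod w1 * (C * r)" by (simp add: algebra_simps)
  also have "\<dots> \<le> E * (C * r\<^sup>2) + 1 * (C * r)"
    by (intro add_mono mult_mono[OF w2 a] mult_right_mono[OF w1]) (use E C0 r in auto)
  also have "\<dots> \<le> E * (C * r) + 1 * (C * r)"
    using r C0 E by (intro add_mono mult_left_mono order_refl) (auto simp: power2_eq_square mult_le_one intro: mult_left_le)
  also have "\<dots> = K * r" unfolding K by (simp add: algebra_simps)
  finally have "3/2 * cmod w1 ^ 5 \<le> K * r" .
  moreover have "0 \<le> cmod w1 ^ 5" by simp
  ultimately have "cmod w1 ^ 5 \<le> K * r" by linarith
  then show ?thesis unfolding w1_def \<omega>_def .
qed

lemma hyperbolic_derivative_small: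
  assumes "\<eta> > 0"
  shows "\<exists>\<delta>>0. \<delta> \<le> 1/2 \<and> (\<forall>h g. pair_schwarzian_le \<delta> h g \<longrightarrow>
     (\<forall>z\<in>unit_disk. cmod (deriv (dil h g) z) * (1 - (cmod z)\<^sup>2) \<le> \<eta> * (1 - (cmod (dil h g z))\<^sup>2)))"
proof -
  define K where "K = ((2 + 23 * 153600 ^ 3) * (1 + 153600) :: real)"
  have K: "K > 0" unfolding K_def by simp
  \<comment> \<open>The radius makes the fifth power of the derivative at most \<open>\<eta>\<^sup>5\<close>; the norm allowed is its cube.\<close>
  define r where "r = min (1/16) (\<eta> ^ 5 / K)"
  have r: "0 < r" "r \<le> 1/16" "r \<le> \<eta> ^ 5 / K" 
    using assms K unfolding r_def by (simp_all only: min.cobounded1 min.cobounded2) simp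
  have Kr: "K * r \<le> \<eta> ^ 5" using r(3) K by (simp add: field_simps)
  have r3: "r ^ 3 \<le> 1/2" using power_mono[OF r(2), of 3] r(1) by (simp add: eval_nat_numeral)
  have "cmod (deriv (dil h g) z) * (1 - (cmod z)\<^sup>2) \<le> \<eta> * (1 - (cmod (dil h g z))\<^sup>2)"
    if le: "pair_schwarzian_le (r ^ 3) h g" and z: "z \<in> unit_disk" for h g z
  proof -
    have sp: "sense_preserving_pair h g" using le unfolding pair_schwarzian_le_def by blast
    obtain H G where HG: "pair_schwarzian_le (r ^ 3) H G" "dil H G 0 = 0"
      "cmod (deriv (dil H G) 0) = cmod (deriv (dil h g) z) * (1 - (cmod z)\<^sup>2) / (1 - (cmod (dil h g z))\<^sup>2)"
      using normalization_at_point[OF sp z] le by blast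
    have "cmod (deriv (dil H G) 0) ^ 5 \<le> \<eta> ^ 5"
      using dilatation_derivative_small[OF r(1,2) HG(1,2), folded K_def] Kr by linarith
    then have "cmod (deriv (dil H G) 0) \<le> \<eta>" by (rule power_mono_iff[THEN iffD1, rotated 3]) (use assms in auto)
    moreover have "1 - (cmod (dil h g z))\<^sup>2 > 0"
      using sense_preserving_pairD(4)[OF sp z] by (simp add: abs_square_less_1)
    ultimately show ?thesis unfolding HG(3) by (simp add: field_simps)
  qed
  then show ?thesis using r(1) r3 by (intro exI[of _ "r ^ 3"]) auto
qed

text \<open>
  At a normalized point \<open>S(h + \<epsilon> g) = S\<^sub>f - \<epsilon> ((h''/h') \<omega>' - \<omega>'') - (3/2) (\<epsilon> \<omega>')\<^sup>2\<close>. The hyperbolic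
  derivative of \<open>\<omega>\<close> is small everywhere, so \<open>\<omega>'\<close> is small near the origin, hence so is \<open>\<omega>''(0)\<close> by Cauchy's
  estimate, while \<open>h''/h'\<close> is bounded by 10.
\<close>

lemma combination_schwarzian_bound:
  "\<exists>\<delta>>0. \<forall>h g. pair_schwarzian_le \<delta> h g \<longrightarrow> (\<forall>z\<in>unit_disk. \<forall>\<epsilon>. cmod \<epsilon> = 1 \<longrightarrow>
     cmod (schwarzian (\<lambda>w. h w + \<epsilon> * g w) z) * (1 - (cmod z)\<^sup>2)\<^sup>2 \<le> 2)"
proof -
  \<comment> \<open>The value 1/10 keeps the final sum \<open>1/2 + 1 + 8/30 + 3/200\<close> below 2.\<close>
  obtain \<delta> where \<delta>: "\<delta> > 0" "\<delta> \<le> 1/2" and small: "\<And>h g z. pair_schwarzian_le \<delta> h g \<Longrightarrow> z \<in> unit_disk \<Longrightarrow>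
      cmod (deriv (dil h g) z) * (1 - (cmod z)\<^sup>2) \<le> 1/10 * (1 - (cmod (dil h g z))\<^sup>2)"
    using hyperbolic_derivative_small[of "1/10"] by auto
  have 0: "0 \<in> unit_disk" by simp
  have "cmod (schwarzian (\<lambda>w. h w + \<epsilon> * g w) z) * (1 - (cmod z)\<^sup>2)\<^sup>2 \<le> 2"
    if le: "pair_schwarzian_le \<delta> h g" and z: "z \<in> unit_disk" and e: "cmod \<epsilon> = 1" for h g z \<epsilon>
  proof -
    have sp: "sense_preserving_pair h g" using le unfolding pair_schwarzian_le_def by blast
    obtain H G b where HG: "pair_schwarzian_le \<delta> H G" "dil H G 0 = 0" and b: "cmod b = 1" and
      eq: "cmod (schwarzian (\<lambda>w. h w + \<epsilon> * g w) z) * (1 - (cmod z)\<^sup>2)\<^sup>2 = cmod (schwarzian (\<lambda>w. H w + b * G w) 0)"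
      using normalization_at_point[OF sp z] le e by blast
    have spH: "sense_preserving_pair H G" using HG(1) unfolding pair_schwarzian_le_def by blast
    note hol = sense_preserving_pairD[OF spH]
    have le1: "pair_schwarzian_le 1 H G" 
      using HG(1) order_trans[of _ \<delta> 1] \<delta>(2) unfolding pair_schwarzian_le_def by auto
    define \<omega> where "\<omega> = dil H G"
    have w00: "\<omega> 0 = 0" using HG(2) \<omega>_def by simp
    have w1: "cmod (deriv \<omega> 0) \<le> 1/10" using small[OF HG(1) 0] HG(2) unfolding \<omega>_def by simp
    have wb: "cmod (deriv \<omega> x) \<le> 4/30" if x: "cmod x \<le> 1/2" for x
    proof -
      have "(cmod x)\<^sup>2 \<le> (1/2)\<^sup>2" using x by (intro power_mono) auto
      then have "3/4 \<le> 1 - (cmod x)\<^sup>2" by (simp add: power2_eq_square)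
      then have "cmod (deriv \<omega> x) * (3/4) \<le> cmod (deriv \<omega> x) * (1 - (cmod x)\<^sup>2)" by (intro mult_left_mono) auto
      also have "\<dots> \<le> 1/10 * (1 - (cmod (\<omega> x))\<^sup>2)" unfolding \<omega>_def using x by (intro small[OF HG(1)]) auto
      also have "\<dots> \<le> 1/10" by simp
      finally show ?thesis by simp
    qed
    have w2: "cmod (deriv (deriv \<omega>) 0) \<le> 8/30"
    proof -
      have dw: "deriv \<omega> holomorphic_on unit_disk" unfolding \<omega>_def by (intro holomorphic_intros hol open_ball)
      have "cmod ((deriv ^^ 1) (deriv \<omega>) 0) \<le> fact 1 * (4/30) / (1/2) ^ 1"
      proof (rule Cauchy_inequality)
        show "deriv \<omega> holomorphic_on ball 0 (1/2)" using dw by (rule holomorphic_on_subset) auto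
        show "continuous_on (cball 0 (1/2)) (deriv \<omega>)"
          by (rule continuous_on_subset[OF holomorphic_on_imp_continuous_on[OF dw]]) auto
      qed (use wb in auto)
      then show ?thesis by simp
    qed
    have P: "cmod (pre_schwarzian H 0) \<le> 10"
      using harmonic_pre_schwarzian_bound[OF le1, of 0] HG(2) unfolding harmonic_pre_schwarzian_def by simp
    have S: "cmod (schwarzian H 0) \<le> 1/2"
    proof -
      have "pair_schwarzian H G 0 = schwarzian H 0" using pair_schwarzian_formula[OF spH 0] HG(2) by simp
      moreover have "cmod (pair_schwarzian H G 0) \<le> \<delta>" using HG(1) 0 unfolding pair_schwarzian_le_def by fastforce
      ultimately show ?thesis using \<delta> by simp
    qed
    have "schwarzian (\<lambda>w. H w + b * G w) 0 = schwarzian H 0 - b * (pre_schwarzian H 0 * deriv \<omega> 0 - deriv (deriv \<omega>) 0)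
       - 3/2 * (b * deriv \<omega> 0)\<^sup>2"
      using schwarzian_combination[OF spH _ 0, of b] b w00 unfolding \<omega>_def by simp
    also have "cmod \<dots> \<le> cmod (schwarzian H 0) + cmod (b * (pre_schwarzian H 0 * deriv \<omega> 0 - deriv (deriv \<omega>) 0))
       + cmod (3/2 * (b * deriv \<omega> 0)\<^sup>2)"
      by (meson add_mono norm_triangle_ineq4 order_refl order_trans)
    also have "cmod (b * (pre_schwarzian H 0 * deriv \<omega> 0 - deriv (deriv \<omega>) 0)) \<le> 10 * (1/10) + 8/30"
    proof -
      have "cmod (pre_schwarzian H 0 * deriv \<omega> 0) \<le> 10 * (1/10)" unfolding norm_mult using P w1 by (intro mult_mono) auto
      then show ?thesis using w2 b norm_triangle_ineq4[of "pre_schwarzian H 0 * deriv \<omega> 0" "deriv (deriv \<omega>) 0"]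
        by (simp add: norm_mult[of b])
    qed
    also have "cmod (3/2 * (b * deriv \<omega> 0)\<^sup>2) \<le> 3/2 * (1/10)\<^sup>2"
    proof -
      have "(cmod (deriv \<omega> 0))\<^sup>2 \<le> (1/10)\<^sup>2" using w1 by (intro power_mono) auto
      then show ?thesis using b by (simp add: norm_mult norm_power)
    qed
    finally show ?thesis unfolding eq using S by (simp add: power2_eq_square)
  qed
  then show ?thesis using \<delta>(1) by blast
qed

section \<open>Univalence\<close>

text \<open>
  If \<open>h + cnj \<circ> g\<close> identifies two points, the increments of \<open>h\<close> and \<open>g\<close> between them have the same modulus,
  so a rotation of \<open>g\<close> cancels that of \<open>h\<close>.
\<close>

lemma stable_univalence:
  assumes inj: "\<And>\<epsilon>. cmod \<epsilon> = 1 \<Longrightarrow> inj_on (\<lambda>z. h z + \<epsilon> * g z) D"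
  shows "inj_on (\<lambda>z. h z + cnj (g z)) D"
proof (rule inj_onI, rule ccontr)
  fix x y assume xy: "x \<in> D" "y \<in> D" "h x + cnj (g x) = h y + cnj (g y)" "x \<noteq> y"
  define u where "u = h x - h y"
  define v where "v = g x - g y"
  have uv: "u = - cnj v" unfolding u_def v_def using xy(3) by (simp add: algebra_simps)
  obtain \<epsilon> where e: "cmod \<epsilon> = 1" "u + \<epsilon> * v = 0"
  proof (cases "v = 0")
    case True then show ?thesis using uv that[of 1] by simp
  next
    case False then show ?thesis using uv by (intro that[of "cnj v / v"]) (auto simp: norm_divide)
  qed
  have "h x + \<epsilon> * g x = h y + \<epsilon> * g y" using e(2) unfolding u_def v_def by (simp add: algebra_simps)
  then show False using inj_onD[OF inj[OF e(1)], of x y] xy by blast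
qed

theorem theorem1:
  shows "\<exists>\<delta>\<^sub>0::real. \<delta>\<^sub>0 > 0 \<and>
    (\<forall>f :: complex \<Rightarrow> complex.
       sense_preserving_harmonic f \<and> schwarzian_norm f \<le> ereal \<delta>\<^sub>0 \<longrightarrow> inj_on f unit_disk)"
proof -
  obtain \<delta> where \<delta>: "\<delta> > 0" and bound: "\<And>h g z \<epsilon>. pair_schwarzian_le \<delta> h g \<Longrightarrow> z \<in> unit_disk \<Longrightarrow> cmod \<epsilon> = 1 \<Longrightarrow>
     cmod (schwarzian (\<lambda>w. h w + \<epsilon> * g w) z) * (1 - (cmod z)\<^sup>2)\<^sup>2 \<le> 2"
    using combination_schwarzian_bound by blast
  have "inj_on f unit_disk" if f: "sense_preserving_harmonic f" and norm: "schwarzian_norm f \<le> ereal \<delta>" for f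
  proof -
    define h where "h = analytic_part f"
    define g where "g = coanalytic_part f"
    have "\<exists>p. case p of (h, g) \<Rightarrow> canonical_decomposition f h g"
      using harmonic_on_imp_canonical_decomposition f unfolding sense_preserving_harmonic_def by auto
    then have "case canonical_parts f of (h, g) \<Rightarrow> canonical_decomposition f h g"
      unfolding canonical_parts_def by (rule someI_ex)
    then have dec: "canonical_decomposition f h g"
      unfolding h_def g_def analytic_part_def coanalytic_part_def by (simp add: case_prod_beta)
    have sp: "sense_preserving_pair h g"
      unfolding sense_preserving_pair_def
    proof (intro conjI ballI)
      show "h holomorphic_on unit_disk" "g holomorphic_on unit_disk"
        using dec unfolding canonical_decomposition_def by auto
      show "cmod (deriv g z) < cmod (deriv h z)" if "z \<in> unit_disk" for z
      proof -
        have "(cmod (deriv g z))\<^sup>2 < (cmod (deriv h z))\<^sup>2"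
          using f that unfolding sense_preserving_harmonic_def jacobian_def h_def g_def by auto
        then show ?thesis by (rule power2_less_imp_less) simp
      qed
    qed
    have dil: "dilatation f = dil h g" unfolding dilatation_def dil_def h_def g_def by (rule ext) simp
    have "harmonic_schwarzian f z = pair_schwarzian h g z" if "z \<in> unit_disk" for z
      unfolding harmonic_schwarzian_def Let_def dil h_def[symmetric] pair_schwarzian_formula[OF sp that]
        one_minus_cnj_mult pre_schwarzian_def
      by simp
    moreover have "cmod (harmonic_schwarzian f z) * (1 - (cmod z)\<^sup>2)\<^sup>2 \<le> \<delta>" if "z \<in> unit_disk" for z
    proof -
      have "ereal (cmod (harmonic_schwarzian f z) * (1 - (cmod z)\<^sup>2)\<^sup>2) \<le> schwarzian_norm f"
        unfolding schwarzian_norm_def by (rule SUP_upper[OF that])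
      then show ?thesis using norm by (metis ereal_less_eq(3) order_trans)
    qed
    ultimately have le: "pair_schwarzian_le \<delta> h g" unfolding pair_schwarzian_le_def using sp by simp
    have "inj_on (\<lambda>z. h z + \<epsilon> * g z) unit_disk" if e: "cmod \<epsilon> = 1" for \<epsilon>
      using Nehari_univalence_criterion[OF combination_locally_univalent(1)[OF sp, of \<epsilon>]]
        combination_locally_univalent(3)[OF sp, of \<epsilon>] bound[OF le _ e] e by auto
    then have "inj_on (\<lambda>z. h z + cnj (g z)) unit_disk" by (rule stable_univalence)
    then show ?thesis
      by (rule inj_on_cong[THEN iffD1, rotated]) (use dec in \<open>auto simp: canonical_decomposition_def\<close>)
  qed
  then show ?thesis using \<delta> by blast
qed

end
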